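(* Let $\mathcal{H}_i = (E_i; X^1_{i}, X^2_{i}, X^3_{i})$, $i \in \mathbb{N}$, be a sequence of finite $3$-partite $3$-hypergraphs such that each $\mathcal{H}_i$ embeds as an induced $3$-partite sub-$3$-hypergraph into $\mathrm{GS}_3$, and also embeds as an induced $3$-partite sub-$3$-hypergraph into the half-simplex. Then the family $\{\mathcal{H}_i : i\in\mathbb{N}\}$ satisfies perfect $2$-stable regularity.
   Context: A $3$-partite $3$-hypergraph $(E;X^1,X^2,X^3)$ consists of sets (parts) $X^1,X^2,X^3$ and a relation $E\subseteq X^1\times X^2\times X^3$; it is finite if its parts are finite. An embedding of $(E;X^1,X^2,X^3)$ as an induced $3$-partite sub-$3$-hypergraph into $(E';Y^1,Y^2,Y^3)$ is a triple of injective maps $g_u:X^u\to Y^u$, $u\in\{1,2,3\}$, such that $(x,y,z)\in E\iff (g_1(x),g_2(y),g_3(z))\in E'$ for all $(x,y,z)\in X^1\times X^2\times X^3$. Half-simplex: the $3$-partite $3$-hypergraph where each part is a copy of $\mathbb{Q}\cap[0,1]$ and $(x,y,z)$ is an edge exactly when $x+y+z\geq 1$. $\mathrm{GS}_3$: the $3$-partite $3$-hypergraph where each part is a copy of $\mathbb{F}_3^{\omega}$ (infinite sequences of elements of $\mathbb{F}_3$), and $(x,y,z)$ is an edge exactly when there is some $n\in\omega$ with $x(n)+y(n)+z(n)\neq 0$ in $\mathbb{F}_3$ and, for the least such $n$, $x(n)+y(n)+z(n)=1$. Ultraproducts. Let $(f_i;X_{1,i},\ldots,X_{k,i})$, $i\in\mathbb{N}$,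 be a sequence with each $X_{u,i}$ a finite set and $f_i:\prod_{u\in[k]}X_{u,i}\to[0,1]$; let $\mu_{u,i}$ be a probability measure on the finite set $X_{u,i}$ (all subsets measurable), and for $e\subseteq[k]=\{1,\ldots,k\}$ let $\mu_{e,i}$ be the product measure on $\prod_{u\in e}X_{u,i}$. Let $\mathcal{U}$ be a non-principal ultrafilter on $\mathbb{N}$. Let $X_u:=\prod_{i}X_{u,i}/\mathcal{U}$ and let $f:\prod_{u\in[k]}X_u\to[0,1]$ be $f(x_1,\ldots,x_k):=\inf\{q\in\mathbb{Q}: f_i(x_{1,i},\ldots,x_{k,i})<q\text{ for }\mathcal{U}\text{-many }i\}$, where $x_u$ is the class of $(x_{u,i})_i$. For $e\subseteq[k]$, let $\mathcal{B}_{e,0}$ be the Boolean algebra of internal subsets of $\prod_{u\in e}X_u$ (ultraproducts $\prod_i Y_i/\mathcal{U}$ with $Y_i\subseteq\prod_{u\in e}X_{u,i}$), let $\mathcal{B}_e$ be the $\sigma$-algebra generated by $\mathcal{B}_{e,0}$, and let $\mu_e$ be the unique countably additive probability measure on $\mathcal{B}_e$ with $\mu_e(\prod_iY_i/\mathcal{U})=\lim_{\mathcal{U}}\mu_{e,i}(Y_i)$. Perfect $d$-stable regularity ($1\le d\le k$). The ultraproduct function $f$ satisfies perfect $d$-stable regularity if for every real $\varepsilon>0$ there exist, for every $e\in\binom{[k]}{d}$ (a $d$-element subset of $[k]$), countable partitions $\{A_{e,t}:t\in\mathbb{N}\}$ of $\prod_{u\in e}X_u$ with all $A_{e,t}\in\mathcal{B}_e$,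 such that for every choice of indices $(t_e\in\mathbb{N}:e\in\binom{[k]}{d})$ there is an interval $I\subseteq[0,1]$ of length at most $\varepsilon$ with $f(\vec x)\in I$ for all $\vec x$ in the cylinder intersection set $\{\vec x\in\prod_{u\in[k]}X_u:(x_u)_{u\in e}\in A_{e,t_e}\text{ for all }e\in\binom{[k]}{d}\}$ outside of a set of $\mu_{[k]}$-measure $0$. A family $\mathcal{F}$ of functions $(f;X_1,\ldots,X_k)$ on products of $k$ finite sets with values in $[0,1]$ satisfies perfect $d$-stable regularity if for every sequence of members of $\mathcal{F}$, every choice of the probability measures $\mu_{u,i}$ and every non-principal ultrafilter $\mathcal{U}$ on $\mathbb{N}$, the associated ultraproduct function satisfies perfect $d$-stable regularity. A hypergraph is identified with the characteristic function of its edge relation (here $k=3$, $d=2$). *)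

theory Defs
  imports "HOL-Probability.Probability" "HOL-Library.Numeral_Type"
begin

section \<open>3-partite 3-hypergraphs\<close>

(* The three parts may share elements: membership in part 1, 2 or 3 is determined by the
   coordinate. Only the values of part at 1, 2, 3 are relevant. *)
record 'a hypergraph3 =
  edges :: "('a \<times> 'a \<times> 'a) set"
  part :: "nat \<Rightarrow> 'a set"

definition tripartite3 :: "'a hypergraph3 \<Rightarrow> bool" where
  "tripartite3 H \<longleftrightarrow> edges H \<subseteq> part H 1 \<times> part H 2 \<times> part H 3"

definition finite_hypergraph3 :: "'a hypergraph3 \<Rightarrow> bool" where
  "finite_hypergraph3 H \<longleftrightarrow> (\<forall>u\<in>{1, 2, 3}. finite (part H u))"

definition embeds_induced :: "'a hypergraph3 \<Rightarrow> 'b hypergraph3 \<Rightarrow> bool" where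
  "embeds_induced H H' \<longleftrightarrow>
     (\<exists>g :: nat \<Rightarrow> 'a \<Rightarrow> 'b.
        (\<forall>u\<in>{1, 2, 3}. g u \<in> part H u \<rightarrow> part H' u \<and> inj_on (g u) (part H u)) \<and>
        (\<forall>x\<in>part H 1. \<forall>y\<in>part H 2. \<forall>z\<in>part H 3.
           (x, y, z) \<in> edges H \<longleftrightarrow> (g 1 x, g 2 y, g 3 z) \<in> edges H'))"

definition half_simplex :: "rat hypergraph3" where
  "half_simplex =
     \<lparr> edges = {(x, y, z). x \<in> {0..1} \<and> y \<in> {0..1} \<and> z \<in> {0..1} \<and> x + y + z \<ge> 1},
       part = (\<lambda>_. {0..1}) \<rparr>"

(* Ring operations on the numeral type 3 are modulo 3. *)
type_synonym F3 = 3

definition GS3 :: "(nat \<Rightarrow> F3) hypergraph3" where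
  "GS3 =
     \<lparr> edges = {(x, y, z). (\<exists>n. x n + y n + z n \<noteq> 0) \<and>
         (let n = (LEAST n. x n + y n + z n \<noteq> 0) in x n + y n + z n = 1)},
       part = (\<lambda>_. UNIV) \<rparr>"


section \<open>Ultraproducts\<close>

definition nonprincipal_ultrafilter :: "'i filter \<Rightarrow> bool" where
  "nonprincipal_ultrafilter U \<longleftrightarrow>
     U \<noteq> bot \<and> (\<forall>P. eventually P U \<or> eventually (\<lambda>i. \<not> P i) U) \<and> (\<forall>j. U \<noteq> principal {j})"

definition ultra_rel :: "nat filter \<Rightarrow> (nat \<Rightarrow> 'a set) \<Rightarrow> ((nat \<Rightarrow> 'a) \<times> (nat \<Rightarrow> 'a)) set" where
  "ultra_rel U X =
     {(x, y). x \<in> Pi UNIV X \<and> y \<in> Pi UNIV X \<and> eventually (\<lambda>i. x i = y i) U}"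

definition ultraproduct :: "nat filter \<Rightarrow> (nat \<Rightarrow> 'a set) \<Rightarrow> (nat \<Rightarrow> 'a) set set" where
  "ultraproduct U X = Pi UNIV X // ultra_rel U X"

(* Throughout, X u i is the part with label u of the i-th structure of the sequence, and
   a point of a product over a label set e is an extensional function on e. *)
abbreviation ultra_space ::
    "nat filter \<Rightarrow> (nat \<Rightarrow> nat \<Rightarrow> 'a set) \<Rightarrow> nat set \<Rightarrow> (nat \<Rightarrow> (nat \<Rightarrow> 'a) set) set" where
  "ultra_space U X e \<equiv> PiE e (\<lambda>u. ultraproduct U (X u))"

(* The ultraproduct of the sets Y i, each a subset of the product of the X u i over u in e,
   seen as a subset of the product of the ultraproducts. Membership does not depend on
   the choice of representatives y u of the classes x u; likewise in ultra_fun below. *)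
definition internal_set ::
    "nat filter \<Rightarrow> (nat \<Rightarrow> nat \<Rightarrow> 'a set) \<Rightarrow> nat set \<Rightarrow> (nat \<Rightarrow> (nat \<Rightarrow> 'a) set)
      \<Rightarrow> (nat \<Rightarrow> (nat \<Rightarrow> 'a) set) set" where
  "internal_set U X e Y =
     {x \<in> ultra_space U X e.
        \<exists>y. (\<forall>u\<in>e. y u \<in> x u) \<and> eventually (\<lambda>i. (\<lambda>u\<in>e. y u i) \<in> Y i) U}"

definition ultra_fun ::
    "nat \<Rightarrow> nat filter \<Rightarrow> (nat \<Rightarrow> (nat \<Rightarrow> 'a) \<Rightarrow> real) \<Rightarrow> (nat \<Rightarrow> (nat \<Rightarrow> 'a) set) \<Rightarrow> real" where
  "ultra_fun k U f x =
     Inf {q \<in> \<rat>. \<exists>y. (\<forall>u\<in>{1..k}. y u \<in> x u) \<and>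
                      eventually (\<lambda>i. f i (\<lambda>u\<in>{1..k}. y u i) < q) U}"

(* The sigma-algebra generated by the internal sets, with the measure extending the ultralimit
   of the finite product measures; M u i is the probability measure on X u i. For a
   nonprincipal ultrafilter such an extension exists by countable saturation, and it is
   unique, so the default value of extend_measure is never taken. *)
definition loeb_measure ::
    "nat filter \<Rightarrow> (nat \<Rightarrow> nat \<Rightarrow> 'a set) \<Rightarrow> (nat \<Rightarrow> nat \<Rightarrow> 'a measure) \<Rightarrow> nat set
      \<Rightarrow> (nat \<Rightarrow> (nat \<Rightarrow> 'a) set) measure" where
  "loeb_measure U X M e =
     extend_measure (ultra_space U X e)
       {Y. \<forall>i. Y i \<subseteq> PiE e (\<lambda>u. X u i)}
       (internal_set U X e)
       (\<lambda>Y. ennreal (Lim U (\<lambda>i. measure (PiM e (\<lambda>u. M u i)) (Y i))))"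


section \<open>Perfect stable regularity\<close>

(* A countable partition is indexed by all of nat, so pieces may be empty. An interval of
   length at most eps inside [0,1] may be taken closed. *)
definition perfect_stable_regularity_ultra ::
    "nat \<Rightarrow> nat \<Rightarrow> nat filter \<Rightarrow> (nat \<Rightarrow> nat \<Rightarrow> 'a set) \<Rightarrow> (nat \<Rightarrow> nat \<Rightarrow> 'a measure)
      \<Rightarrow> (nat \<Rightarrow> (nat \<Rightarrow> 'a) \<Rightarrow> real) \<Rightarrow> bool" where
  "perfect_stable_regularity_ultra k d U X M f \<longleftrightarrow>
     (\<forall>\<epsilon>>0. \<exists>A :: nat set \<Rightarrow> nat \<Rightarrow> (nat \<Rightarrow> (nat \<Rightarrow> 'a) set) set.
        (\<forall>e. e \<subseteq> {1..k} \<and> card e = d \<longrightarrow>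
           range (A e) \<subseteq> sets (loeb_measure U X M e) \<and>
           disjoint_family (A e) \<and>
           (\<Union>t. A e t) = ultra_space U X e) \<and>
        (\<forall>t :: nat set \<Rightarrow> nat. \<exists>a b. 0 \<le> a \<and> a \<le> b \<and> b \<le> 1 \<and> b - a \<le> \<epsilon> \<and>
           (AE x in loeb_measure U X M {1..k}.
              (\<forall>e. e \<subseteq> {1..k} \<and> card e = d \<longrightarrow> restrict x e \<in> A e (t e))
                \<longrightarrow> ultra_fun k U f x \<in> {a..b})))"

(* A member (f, X) of the family is a function f on the product of X 1, ..., X k. *)
definition perfect_stable_regularity ::
    "nat \<Rightarrow> nat \<Rightarrow> (((nat \<Rightarrow> 'a) \<Rightarrow> real) \<times> (nat \<Rightarrow> 'a set)) set \<Rightarrow> bool" where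
  "perfect_stable_regularity k d F \<longleftrightarrow>
     (\<forall>f X M U.
        (\<forall>i. (f i, \<lambda>u. X u i) \<in> F) \<and>
        (\<forall>u\<in>{1..k}. \<forall>i. prob_space (M u i) \<and> sets (M u i) = Pow (X u i)) \<and>
        nonprincipal_ultrafilter U
        \<longrightarrow> perfect_stable_regularity_ultra k d U X M f)"

definition hypergraph_fun :: "'a hypergraph3 \<Rightarrow> (nat \<Rightarrow> 'a) \<Rightarrow> real" where
  "hypergraph_fun H p = of_bool ((p 1, p 2, p 3) \<in> edges H)"

end

(*
Read GS3 as three ternary trees: a vertex is a branch, and a triple is decided at the first level
where its three branches do not sum to zero. Two vertices x, y determine a branch -(x + y) of the
third tree. If changing any one coordinate below the deciding level could flip the edge relation,
then, by monotonicity of the half-simplex, so would changing any two or all three of them, which is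
impossible in F_3. Hence in every triple some pair has already decided the edge relation when the
triple reaches its deciding level, and the pair deciding earliest is always right.

Comparing the levels of the pairs is an order relation, so it cannot be read off directly from
countably many types. Fix countably many landmark branches in each tree such that any node
avoiding all of them has infinitesimal measure. A pair records the last landmarks it follows until
it decides, its decision, the landmarks which its members follow after leaving these, and which
of them leaves first. If two pairs of a triple that decide while following the same landmarks
disagree, the vertex outside the wrong pair is the first to leave them, and this is visible in the
recorded data. So almost everywhere the three types determine the edge relation.
*)
theory Submission
  imports Defs
begin

section \<open>Branches and their first nonvanishing level\<close>

definition agree :: "nat \<Rightarrow> (nat \<Rightarrow> F3) \<Rightarrow> (nat \<Rightarrow> F3) \<Rightarrow> bool" where
  "agree n h h' \<longleftrightarrow> (\<forall>m<n. h m = h' m)"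

lemma agree_sym: "agree n h h' \<longleftrightarrow> agree n h' h"
  by (auto simp: agree_def)

lemma agree_trans: "agree n h h' \<Longrightarrow> agree n h' h'' \<Longrightarrow> agree n h h''"
  by (auto simp: agree_def)

lemma agree_mono: "agree n h h' \<Longrightarrow> m \<le> n \<Longrightarrow> agree m h h'"
  by (auto simp: agree_def)

lemma edges_GS3_iff:
  assumes "\<forall>m<n. x m + y m + z m = 0" "x n + y n + z n \<noteq> 0"
  shows "(x, y, z) \<in> edges GS3 \<longleftrightarrow> x n + y n + z n = 1"
proof -
  have "(LEAST n. x n + y n + z n \<noteq> 0) = n"
    using assms by (intro Least_equality) (auto simp: not_less[symmetric])
  with assms(2) show ?thesis by (auto simp: GS3_def Let_def)
qed

text \<open>The Davenport constant of the group \<open>F3\<close> is 3: among any three elements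
  some nonempty subfamily sums to zero. This is a finite check.\<close>

lemma F3_zero_subsum:
  fixes a b c :: F3
  assumes "a \<noteq> 0" "b \<noteq> 0" "c \<noteq> 0" "a + b \<noteq> 0" "a + c \<noteq> 0" "b + c \<noteq> 0"
  shows "a + b + c = 0"
proof -
  have all: "(\<forall>a b c::F3. a \<noteq> 0 \<longrightarrow> b \<noteq> 0 \<longrightarrow> c \<noteq> 0 \<longrightarrow> a + b \<noteq> 0 \<longrightarrow> a + c \<noteq> 0 \<longrightarrow> b + c \<noteq> 0
    \<longrightarrow> a + b + c = 0)"
    unfolding forall_3 by simp
  show ?thesis using all assms by blast
qed

text \<open>If flipping each single coordinate changes the relation, then by monotonicity of the half-simplex
  flipping any nonempty set of coordinates changes it, which is impossible at the first
  nonvanishing level of \<open>GS3\<close>.\<close>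
lemma some_coordinate_irrelevant:
  fixes a :: "nat \<Rightarrow> 'a \<Rightarrow> rat" and g :: "nat \<Rightarrow> 'a \<Rightarrow> nat \<Rightarrow> F3"
  assumes half: "\<And>p q r. p \<in> {x, x'} \<Longrightarrow> q \<in> {y, y'} \<Longrightarrow> r \<in> {z, z'} \<Longrightarrow>
      R p q r \<longleftrightarrow> a 1 p + a 2 q + a 3 r \<ge> 1"
    and gs: "\<And>p q r. p \<in> {x, x'} \<Longrightarrow> q \<in> {y, y'} \<Longrightarrow> r \<in> {z, z'} \<Longrightarrow>
      R p q r \<longleftrightarrow> (g 1 p, g 2 q, g 3 r) \<in> edges GS3"
    and van: "\<forall>m<n. g 1 x m + g 2 y m + g 3 z m = 0" and non: "g 1 x n + g 2 y n + g 3 z n \<noteq> 0"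
    and agr: "agree n (g 1 x') (g 1 x)" "agree n (g 2 y') (g 2 y)" "agree n (g 3 z') (g 3 z)"
  shows "R x' y z = R x y z \<or> R x y' z = R x y z \<or> R x y z' = R x y z"
proof (rule ccontr)
  assume flip: "\<not> ?thesis"
  define s where "s p q r = g 1 p n + g 2 q n + g 3 r n" for p q r
  have edge: "R p q r \<longleftrightarrow> s p q r = 1"
    if "p \<in> {x, x'}" "q \<in> {y, y'}" "r \<in> {z, z'}" "s p q r \<noteq> 0" for p q r
  proof -
    have "\<forall>m<n. g 1 p m + g 2 q m + g 3 r m = 0"
      using van agr that by (auto simp: agree_def)
    from edges_GS3_iff[OF this] that gs show ?thesis by (auto simp: s_def)
  qed
  \<comment> \<open>In the half-simplex the three single replacements all push the sum across 1 in
    the same direction, so performing several of them pushes it further that way.\<close>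
  have flip_all: "R p q r \<noteq> R x y z"
    if "p \<in> {x, x'}" "q \<in> {y, y'}" "r \<in> {z, z'}" "(p, q, r) \<noteq> (x, y, z)" for p q r
    using flip that half by (auto; smt (verit))
  have s0: "s x y z \<noteq> 0" using non by (simp add: s_def)
  \<comment> \<open>All eight triples vanish below \<open>n\<close>, so a nonzero value of
    \<open>s\<close> decides \<open>R\<close>. Equal values of \<open>s\<close> would therefore give
    equal values of \<open>R\<close>.\<close>
  have ne: "s p q r \<noteq> s x y z"
    if "p \<in> {x, x'}" "q \<in> {y, y'}" "r \<in> {z, z'}" "(p, q, r) \<noteq> (x, y, z)" for p q r
    using edge[of p q r] edge[of x y z] flip_all[OF that] s0 that by auto
  have n1: "x' \<noteq> x" "y' \<noteq> y" "z' \<noteq> z" using flip by auto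
  \<comment> \<open>The increments at level \<open>n\<close>; by \<open>ne\<close> no nonempty
    subfamily of \<open>A\<close>, \<open>B\<close>, \<open>C\<close> sums to zero.\<close>
  define A where "A = g 1 x' n - g 1 x n"
  define B where "B = g 2 y' n - g 2 y n"
  define C where "C = g 3 z' n - g 3 z n"
  have "A \<noteq> 0" "B \<noteq> 0" "C \<noteq> 0" "A + B \<noteq> 0" "A + C \<noteq> 0" "B + C \<noteq> 0" "A + B + C \<noteq> 0"
    using ne[of x' y z] ne[of x y' z] ne[of x y z'] ne[of x' y' z] ne[of x' y z'] ne[of x y' z']
      ne[of x' y' z'] n1
    by (auto simp: s_def A_def B_def C_def algebra_simps)
  with F3_zero_subsum show False by blast
qed


section \<open>Codes of pairs\<close>

definition I3 :: "nat set" where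
  "I3 = {1, 2, 3}"

lemma finite_I3 [simp]: "finite I3" and I3_nonempty [simp]: "I3 \<noteq> {}"
  by (simp_all add: I3_def)

lemma less_enatD: "e < enat K \<Longrightarrow> e = enat (the_enat e) \<and> the_enat e < K"
  by (cases e) auto

text \<open>The branch \<open>g u (x u)\<close> of a vertex determines the nodes of a tree through which it passes.
  The points \<open>c u 0, c u 1, \<dots>\<close> serve as countably many landmarks in the tree of part \<open>u\<close>.
  A pair of vertices is given by a triple \<open>x\<close> together with the index \<open>w\<close> of the ignored
  coordinate.\<close>
locale branching =
  fixes X :: "nat \<Rightarrow> 'a set" and g :: "nat \<Rightarrow> 'a \<Rightarrow> nat \<Rightarrow> F3"
    and E :: "(nat \<Rightarrow> 'a) \<Rightarrow> bool" and c :: "nat \<Rightarrow> nat \<Rightarrow> 'a"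
begin

definition vanish :: "(nat \<Rightarrow> 'a) \<Rightarrow> nat \<Rightarrow> bool" where
  "vanish x n \<longleftrightarrow> (\<forall>m<n. (\<Sum>u\<in>I3. g u (x u) m) = 0)"

text \<open>The branch in tree \<open>w\<close> that a vertex must follow for the triple to keep
  summing to zero.\<close>

definition third :: "nat \<Rightarrow> (nat \<Rightarrow> 'a) \<Rightarrow> nat \<Rightarrow> F3" where
  "third w x m = - (\<Sum>u\<in>I3 - {w}. g u (x u) m)"

definition br :: "nat \<Rightarrow> (nat \<Rightarrow> 'a) \<Rightarrow> nat \<Rightarrow> nat \<Rightarrow> F3" where
  "br w x u = (if u = w then third w x else g u (x u))"

text \<open>The pair has decided at level \<open>n\<close>: the edge relation is constant over the
  vertices in the level-\<open>n\<close> node of the third branch, vacuously so if that node is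
  empty.\<close>

definition const :: "nat \<Rightarrow> (nat \<Rightarrow> 'a) \<Rightarrow> nat \<Rightarrow> bool" where
  "const w x n \<longleftrightarrow> (\<exists>b. \<forall>z\<in>X w. agree n (g w z) (third w x) \<longrightarrow> E (x(w := z)) = b)"

definition stop :: "nat \<Rightarrow> (nat \<Rightarrow> 'a) \<Rightarrow> nat" where
  "stop w x = (LEAST n. const w x n)"

text \<open>The decided value, read at the deciding level. An empty deciding node gives
  \<open>True\<close>; a triple that vanishes up to that level has its own vertex in the node, so
  this default never misleads there.\<close>

definition val :: "nat \<Rightarrow> (nat \<Rightarrow> 'a) \<Rightarrow> bool" where
  "val w x \<longleftrightarrow> (\<forall>z\<in>X w. agree (stop w x) (g w z) (third w x) \<longrightarrow> E (x(w := z)))"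

definition nmin :: "(nat \<Rightarrow> 'a) \<Rightarrow> nat" where
  "nmin x = (MIN w\<in>I3. stop w x)"

text \<open>Names the level-\<open>n\<close> node of \<open>h\<close> by the first landmark that
  passes through it, and by infinity if there is none.\<close>

definition rk :: "nat \<Rightarrow> (nat \<Rightarrow> F3) \<Rightarrow> nat \<Rightarrow> enat" where
  "rk u h n = (INF j\<in>{j. agree n (g u (c u j)) h}. enat j)"

text \<open>The level at which \<open>h\<close> parts from landmark \<open>j\<close>, infinite if it
  never does.\<close>

definition off :: "nat \<Rightarrow> nat \<Rightarrow> (nat \<Rightarrow> F3) \<Rightarrow> enat" where
  "off u j h = (INF m\<in>{m. g u (c u j) m \<noteq> h m}. enat m)"

definition rk_off :: "nat \<Rightarrow> nat \<Rightarrow> (nat \<Rightarrow> F3) \<Rightarrow> enat" where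
  "rk_off u j h = (case off u j h of enat t \<Rightarrow> rk u h (Suc t) | \<infinity> \<Rightarrow> \<infinity>)"

text \<open>The name of the first node that \<open>h\<close> enters after parting from landmark
  \<open>j\<close>. The shift by one frees 0 for the case that there is no name below
  \<open>K\<close>.\<close>

definition lam :: "nat \<Rightarrow> nat \<Rightarrow> nat \<Rightarrow> (nat \<Rightarrow> F3) \<Rightarrow> nat" where
  "lam K u j h = (if rk_off u j h < enat K then Suc (the_enat (rk_off u j h)) else 0)"

text \<open>The last level, up to the deciding one, at which the two vertices and the third branch
  all still have names below \<open>K\<close>.\<close>

definition lev :: "nat \<Rightarrow> nat \<Rightarrow> (nat \<Rightarrow> 'a) \<Rightarrow> nat" where
  "lev K w x = Max {m. m \<le> stop w x \<and> (\<forall>u\<in>I3. rk u (br w x u) m < enat K)}"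

definition pos :: "nat \<Rightarrow> nat \<Rightarrow> (nat \<Rightarrow> 'a) \<Rightarrow> nat \<Rightarrow> nat" where
  "pos K w x u = the_enat (rk u (br w x u) (lev K w x))"

text \<open>Everything is cut off at \<open>K\<close>, so that for fixed \<open>K\<close> codes have an ultralimit; letting \<open>K\<close> tend to
  infinity afterwards, a landmark of infinite rank is one that is never seen.\<close>
definition code :: "nat \<Rightarrow> nat \<Rightarrow> (nat \<Rightarrow> 'a) \<Rightarrow> nat list \<times> bool list \<times> bool \<times> nat list \<times> bool list"
  where "code K w x =
    (map (pos K w x) [1, 2, 3],
     map (\<lambda>u. rk u (br w x u) (stop w x) < enat K) [1, 2, 3],
     val w x,
     map (\<lambda>u. lam K u (pos K w x u) (br w x u)) [1, 2, 3],
     map (\<lambda>(u, v). off u (pos K w x u) (br w x u) < off v (pos K w x v) (br w x v))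
       (List.product [1, 2, 3] [1, 2, 3]))"

text \<open>The landmarks followed by the three vertices at the earliest deciding level; they serve
  as the common reference for all three pairs.\<close>

definition base :: "(nat \<Rightarrow> 'a) \<Rightarrow> nat \<Rightarrow> nat" where
  "base x u = the_enat (rk u (g u (x u)) (nmin x))"

definition generic :: "nat \<Rightarrow> (nat \<Rightarrow> 'a) \<Rightarrow> bool" where
  "generic K x \<longleftrightarrow> (\<forall>u\<in>I3. rk u (g u (x u)) (nmin x) < enat K)"

section \<open>Nodes, ranks and departure levels\<close>

lemma vanish_mono: "vanish x n \<Longrightarrow> m \<le> n \<Longrightarrow> vanish x m"
  by (auto simp: vanish_def)

lemma sum_third: "w \<in> I3 \<Longrightarrow> (\<Sum>u\<in>I3. g u (x u) m) = g w (x w) m - third w x m"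
  unfolding third_def by (subst sum.remove[of _ w]) auto

lemma agree_third: "w \<in> I3 \<Longrightarrow> agree n (g w (x w)) (third w x) \<longleftrightarrow> vanish x n"
  by (simp add: agree_def vanish_def sum_third)

lemma agree_br: "vanish x n \<Longrightarrow> u \<in> I3 \<Longrightarrow> agree n (br w x u) (g u (x u))"
  using agree_third[of u n x] by (auto simp: br_def agree_sym) (auto simp: agree_def)

lemma br_other: "u \<noteq> w \<Longrightarrow> br w x u = g u (x u)"
  by (simp add: br_def)

lemma rk_mono: "m \<le> n \<Longrightarrow> rk u h m \<le> rk u h n"
  unfolding rk_def by (rule INF_superset_mono) (auto intro: agree_mono)

lemma rk_cong: "agree n h h' \<Longrightarrow> rk u h n = rk u h' n"
  unfolding rk_def by (rule INF_cong) (auto intro: agree_trans simp: agree_sym[of n h h'])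

lemma rk_0 [simp]: "rk u h 0 = 0"
proof -
  have "rk u h 0 \<le> enat 0"
    unfolding rk_def by (rule INF_lower) (simp add: agree_def)
  then show ?thesis by (simp flip: zero_enat_def)
qed

lemma INF_enat_attained:
  assumes "(INF j\<in>A. enat j) = enat j"
  shows "j \<in> A"
proof -
  have "enat ` A \<noteq> {}"
    using assms by (auto simp: top_enat_def)
  then have "Inf (enat ` A) \<in> enat ` A"
    by (metis Inf_enat_def LeastI_ex ex_in_conv)
  with assms show ?thesis by auto
qed

lemma rk_enatD: "rk u h n = enat j \<Longrightarrow> agree n (g u (c u j)) h"
  unfolding rk_def using INF_enat_attained by fastforce

lemma rk_le: "agree n (g u (c u j)) h \<Longrightarrow> rk u h n \<le> enat j"
  unfolding rk_def by (rule INF_lower) simp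

lemma rk_ge_iff: "enat K \<le> rk u h n \<longleftrightarrow> (\<forall>j<K. \<not> agree n (g u (c u j)) h)"
  unfolding rk_def le_INF_iff by (auto simp: not_less[symmetric])

lemma off_enatD:
  assumes "off u j h = enat t"
  shows "g u (c u j) t \<noteq> h t" "agree t (g u (c u j)) h"
proof -
  show "g u (c u j) t \<noteq> h t"
    using INF_enat_attained assms unfolding off_def by fastforce
  show "agree t (g u (c u j)) h"
    unfolding agree_def
  proof (intro allI impI, rule ccontr)
    fix m assume "m < t" "g u (c u j) m \<noteq> h m"
    then have "off u j h \<le> enat m" unfolding off_def by (intro INF_lower) simp
    with assms \<open>m < t\<close> show False by simp
  qed
qed

lemma off_eqI:
  assumes "agree t (g u (c u j)) h" "g u (c u j) t \<noteq> h t"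
  shows "off u j h = enat t"
proof (rule antisym)
  show "off u j h \<le> enat t"
    unfolding off_def using assms by (intro INF_lower) simp
  show "enat t \<le> off u j h"
    unfolding off_def le_INF_iff using assms(1) by (auto simp: agree_def not_less[symmetric])
qed

lemma off_greaterI:
  assumes "agree (Suc t) (g u (c u j)) h"
  shows "enat t < off u j h"
proof -
  have "enat (Suc t) \<le> off u j h"
    unfolding off_def le_INF_iff using assms by (auto simp: agree_def not_less[symmetric])
  then show ?thesis by (metis Suc_ile_eq)
qed

text \<open>The new landmark shares with \<open>h\<close> the node just after the departure, so it
  parts from landmark \<open>j\<close> exactly where \<open>h\<close> does. If \<open>h'\<close> has
  the same new landmark, the two departure levels coincide.\<close>

lemma lam_eq_imp_off_eq:
  assumes "lam K u j h = lam K u j h'" "lam K u j h \<noteq> 0"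
  shows "off u j h = off u j h'"
proof -
  have *: "\<exists>t r. off u j h = enat t \<and> rk u h (Suc t) = enat r \<and> lam K u j h = Suc r"
    if "lam K u j h \<noteq> 0" for h
    using that by (auto simp: lam_def rk_off_def dest: less_enatD split: if_splits enat.splits)
  obtain t r where t: "off u j h = enat t" "rk u h (Suc t) = enat r" "lam K u j h = Suc r"
    using * assms by metis
  obtain t' where t': "off u j h' = enat t'" "rk u h' (Suc t') = enat r"
    using * assms t(3) by (metis Suc_inject)
  show ?thesis
    using off_enatD[OF t(1)] off_enatD[OF t'(1)] rk_enatD[OF t(2)] rk_enatD[OF t'(2)] t t'
    by (cases t t' rule: linorder_cases) (auto simp: agree_def)
qed

lemma lev_props:
  assumes "0 < K"
  shows "lev K w x \<le> stop w x" "\<And>u. u \<in> I3 \<Longrightarrow> rk u (br w x u) (lev K w x) < enat K"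
proof -
  let ?S = "{m. m \<le> stop w x \<and> (\<forall>u\<in>I3. rk u (br w x u) m < enat K)}"
  \<comment> \<open>Level 0 belongs to the set because landmark 0 passes through the root; here the
    cutoff has to be positive.\<close>
  have "finite ?S" "0 \<in> ?S"
    using assms by (auto simp flip: zero_enat_def simp: enat_0_iff)
  then have "lev K w x \<in> ?S"
    unfolding lev_def by (intro Max_in) blast+
  then show "lev K w x \<le> stop w x" "\<And>u. u \<in> I3 \<Longrightarrow> rk u (br w x u) (lev K w x) < enat K"
    by auto
qed

lemma le_levI:
  assumes "m \<le> stop w x" "\<And>u. u \<in> I3 \<Longrightarrow> rk u (br w x u) m < enat K"
  shows "m \<le> lev K w x"
  unfolding lev_def using assms by (intro Max_ge) auto

lemma pos_enat:
  assumes "0 < K" "u \<in> I3"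
  shows "rk u (br w x u) (lev K w x) = enat (pos K w x u)" "pos K w x u < K"
  using less_enatD[OF lev_props(2)[OF assms, of w x]] by (auto simp: pos_def)

lemma lev_mono: "0 < K \<Longrightarrow> K \<le> K' \<Longrightarrow> lev K w x \<le> lev K' w x"
  by (intro le_levI) (auto simp: lev_props intro: less_le_trans[OF lev_props(2)])

lemma generic_mono: "generic K x \<Longrightarrow> K \<le> K' \<Longrightarrow> generic K' x"
  by (auto simp: generic_def intro: less_le_trans)

lemma base_enat:
  assumes "generic K x" "u \<in> I3"
  shows "rk u (g u (x u)) (nmin x) = enat (base x u)" "base x u < K"
  using less_enatD[of "rk u (g u (x u)) (nmin x)" K] assms by (auto simp: generic_def base_def)

end

text \<open>The second assumption is what the two embeddings provide: some pair decides at a level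
  up to which the triple still sums to zero.\<close>

locale decided_branching = branching +
  assumes const_exists: "x \<in> Pi I3 X \<Longrightarrow> w \<in> I3 \<Longrightarrow> \<exists>n. const w x n"
    and decided: "x \<in> Pi I3 X \<Longrightarrow> \<exists>w\<in>I3. \<exists>n. vanish x n \<and> const w x n"
begin

section \<open>Predictions of the pairs of a triple\<close>

lemma val_correct:
  assumes "x \<in> Pi I3 X" "w \<in> I3" "vanish x (stop w x)"
  shows "E x \<longleftrightarrow> val w x"
proof -
  have "const w x (stop w x)"
    unfolding stop_def using const_exists[OF assms(1,2)] by (rule LeastI_ex)
  then obtain b where
    b: "\<And>z. z \<in> X w \<Longrightarrow> agree (stop w x) (g w z) (third w x) \<Longrightarrow> E (x(w := z)) = b"
    by (auto simp: const_def)
  have xw: "x w \<in> X w" "agree (stop w x) (g w (x w)) (third w x)"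
    using assms by (auto simp: agree_third)
  then show ?thesis
    using b[OF xw] b by (auto simp: val_def)
qed

lemma nmin_le: "w \<in> I3 \<Longrightarrow> nmin x \<le> stop w x"
  unfolding nmin_def by (intro Min_le) auto

lemma nmin_attained: obtains w where "w \<in> I3" "stop w x = nmin x"
proof -
  have "nmin x \<in> (\<lambda>w. stop w x) ` I3"
    unfolding nmin_def by (intro Min_in) auto
  then show ?thesis using that by auto
qed

text \<open>This allows the pairs of a triple to be compared at \<open>nmin\<close>: below that
  level \<open>br w x u\<close> coincides with the branch of \<open>x u\<close> for every
  \<open>w\<close>.\<close>

lemma vanish_nmin:
  assumes "x \<in> Pi I3 X"
  shows "vanish x (nmin x)"
proof -
  obtain w n where wn: "w \<in> I3" "vanish x n" "const w x n"
    using decided[OF assms] by blast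
  have "stop w x \<le> n"
    unfolding stop_def using wn(3) by (rule Least_le)
  then show ?thesis
    using wn nmin_le[of w x] by (auto intro: vanish_mono)
qed

lemma rk_br_nmin:
  "x \<in> Pi I3 X \<Longrightarrow> u \<in> I3 \<Longrightarrow> rk u (br w x u) (nmin x) = rk u (g u (x u)) (nmin x)"
  by (intro rk_cong agree_br vanish_nmin)

lemma nmin_le_lev:
  assumes "x \<in> Pi I3 X" "generic K x" "w \<in> I3"
  shows "nmin x \<le> lev K w x"
  using assms by (intro le_levI) (auto simp: nmin_le rk_br_nmin generic_def)

text \<open>Ranks grow along a branch, and for a generic triple \<open>lev\<close> does not precede
  \<open>nmin\<close>.\<close>

lemma base_le_pos:
  assumes "x \<in> Pi I3 X" "generic K x" "w \<in> I3" "u \<in> I3"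
  shows "base x u \<le> pos K w x u"
proof -
  have "0 < K" using base_enat(2)[OF assms(2,4)] by simp
  have "rk u (br w x u) (nmin x) \<le> rk u (br w x u) (lev K w x)"
    using assms by (intro rk_mono nmin_le_lev)
  then show ?thesis
    using assms \<open>0 < K\<close> by (simp add: rk_br_nmin base_enat pos_enat)
qed

lemma pos_eq_baseI:
  assumes "x \<in> Pi I3 X" "generic K x" "w \<in> I3" "u \<in> I3"
    and "lev K w x \<le> n" "rk u (br w x u) n \<le> enat (base x u)"
  shows "pos K w x u = base x u"
proof -
  have "0 < K" using base_enat(2)[OF assms(2,4)] by simp
  have "enat (pos K w x u) \<le> enat (base x u)"
    using rk_mono[OF assms(5)] assms(6) \<open>0 < K\<close> assms(4)
    by (metis order_trans pos_enat(1))
  then show ?thesis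
    using base_le_pos[OF assms(1-4)] by simp
qed

text \<open>Lowering the cutoff can only move \<open>lev\<close> back, and \<open>pos\<close> is
  squeezed between \<open>base\<close> and its value at the larger cutoff. It serves to pass from
  cofinally many cutoffs to all large ones.\<close>

lemma pos_eq_base_mono:
  assumes "x \<in> Pi I3 X" "generic K x" "w \<in> I3" "u \<in> I3" "K \<le> K'"
    and "pos K' w x u = base x u"
  shows "pos K w x u = base x u"
proof -
  have "0 < K" using base_enat(2)[OF assms(2,4)] by simp
  then have "rk u (br w x u) (lev K' w x) = enat (base x u)"
    using assms by (simp add: pos_enat)
  then show ?thesis
    using assms \<open>0 < K\<close> by (intro pos_eq_baseI[where n = "lev K' w x"] lev_mono) auto
qed

text \<open>For a generic triple the cutoff has no effect up to \<open>nmin\<close>, and at that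
  level the vertex outside the pair still lies in the deciding node, so the earliest pair is
  right.\<close>

lemma stop_eq_nmin:
  assumes "x \<in> Pi I3 X" "generic K x" "w \<in> I3" "stop w x = nmin x"
  shows "lev K w x = stop w x" "\<And>u. u \<in> I3 \<Longrightarrow> pos K w x u = base x u" "val w x = E x"
proof -
  have "0 < K" using base_enat(2)[OF assms(2,3)] by simp
  then show lev: "lev K w x = stop w x"
    using lev_props(1)[of K w x] nmin_le_lev[OF assms(1-3)] assms(4) by simp
  show "pos K w x u = base x u" if "u \<in> I3" for u
    using assms lev that by (intro pos_eq_baseI[where n = "nmin x"]) (auto simp: rk_br_nmin base_enat)
  show "val w x = E x"
    using val_correct[OF assms(1,3)] vanish_nmin[OF assms(1)] assms(4) by simp
qed

text \<open>If the pair missing \<open>w\<close> predicts the edge relation wrongly although it has not left the base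
  landmarks, then it is the vertex \<open>x w\<close> that leaves them first.\<close>
lemma wrong_val_leaves_first:
  assumes "x \<in> Pi I3 X" "generic K x" "w \<in> I3"
    and pos: "\<And>u. u \<in> I3 \<Longrightarrow> pos K w x u = base x u"
    and lev: "lev K w x = stop w x" and wrong: "val w x \<noteq> E x"
  obtains t where "vanish x t" "off w (base x w) (g w (x w)) = enat t"
    "\<And>u. u \<in> I3 \<Longrightarrow> u \<noteq> w \<Longrightarrow> enat t < off u (base x u) (g u (x u))"
proof -
  have "0 < K" using base_enat(2)[OF assms(2,3)] by simp
  have "\<not> vanish x (stop w x)"
    using val_correct[OF assms(1,3)] wrong by auto
  then obtain m where m: "m < stop w x" "(\<Sum>u\<in>I3. g u (x u) m) \<noteq> 0"
    by (auto simp: vanish_def)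
  \<comment> \<open>The first level where the triple fails to vanish. It precedes
    \<open>stop w x\<close>, and up to the latter the branches of the pair follow the base
    landmarks.\<close>
  define n where "n = (LEAST m. (\<Sum>u\<in>I3. g u (x u) m) \<noteq> 0)"
  have n: "(\<Sum>u\<in>I3. g u (x u) n) \<noteq> 0"
    unfolding n_def using m(2) by (rule LeastI)
  have "n \<le> m"
    unfolding n_def using m(2) by (rule Least_le)
  have vn: "vanish x n"
    unfolding vanish_def n_def using not_less_Least by blast
  have "nmin x \<le> n"
    using vanish_nmin[OF assms(1)] n by (auto simp: vanish_def not_less[symmetric])
  have agr: "agree (Suc n) (g u (c u (base x u))) (br w x u)" if u: "u \<in> I3" for u
  proof -
    have "rk u (br w x u) (lev K w x) = enat (base x u)"
      using pos_enat(1)[OF \<open>0 < K\<close> u] pos[OF u] by simp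
    then have "agree (lev K w x) (g u (c u (base x u))) (br w x u)"
      by (rule rk_enatD)
    then show ?thesis
      by (rule agree_mono) (use \<open>n \<le> m\<close> m(1) lev in simp)
  qed
  show thesis
  proof (rule that[OF vn])
    show "off w (base x w) (g w (x w)) = enat n"
    proof (rule off_eqI)
      have "agree n (br w x w) (g w (x w))"
        using vn assms(3) by (rule agree_br)
      with agree_mono[OF agr[OF assms(3)], of n] show "agree n (g w (c w (base x w))) (g w (x w))"
        using agree_trans by auto
      \<comment> \<open>The base landmark in tree \<open>w\<close> stays on the third branch,
        whereas \<open>x w\<close> leaves that branch at level \<open>n\<close>.\<close>
      have "g w (c w (base x w)) n = third w x n"
        using agr[OF assms(3)] by (auto simp: agree_def br_def)
      then show "g w (c w (base x w)) n \<noteq> g w (x w) n"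
        using n sum_third[OF assms(3)] by auto
    qed
    show "enat n < off u (base x u) (g u (x u))" if "u \<in> I3" "u \<noteq> w" for u
      using agr[OF that(1)] that(2) by (intro off_greaterI) (simp add: br_other)
  qed
qed

text \<open>If \<open>x w\<close> entered a node without a name below \<open>K\<close> when leaving
  its base landmark, this would stop \<open>lev\<close> for the pair missing \<open>v\<close>, which
  contains \<open>x w\<close>. But up to there all branches follow the base landmarks, so every
  position would equal its base.\<close>

lemma leaves_first_lam:
  assumes "x \<in> Pi I3 X" "generic K x" "v \<in> I3" "w \<in> I3" "v \<noteq> w"
    and t: "vanish x t" "off w (base x w) (g w (x w)) = enat t"
      "\<And>u. u \<in> I3 \<Longrightarrow> u \<noteq> w \<Longrightarrow> enat t < off u (base x u) (g u (x u))"
    and pos: "u \<in> I3" "pos K v x u \<noteq> base x u"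
  shows "lam K w (base x w) (g w (x w)) \<noteq> 0"
proof
  assume "lam K w (base x w) (g w (x w)) = 0"
  then have ge: "enat K \<le> rk w (g w (x w)) (Suc t)"
    by (auto simp: lam_def rk_off_def t(2) not_less split: if_splits)
  have "0 < K" using base_enat(2)[OF assms(2,3)] by simp
  \<comment> \<open>Past level \<open>t\<close> the branch of \<open>x w\<close>, which belongs to
    this pair, has rank at least \<open>K\<close>.\<close>
  have "lev K v x \<le> t"
  proof (rule ccontr)
    assume "\<not> ?thesis"
    then have "rk w (g w (x w)) (Suc t) \<le> rk w (br v x w) (lev K v x)"
      using assms(5) by (simp add: br_other rk_mono)
    then show False
      using lev_props(2)[OF \<open>0 < K\<close> assms(4), of v x] ge by simp
  qed
  moreover have "agree t (g u (c u (base x u))) (br v x u)"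
  proof -
    have "enat t \<le> off u (base x u) (g u (x u))"
      using t(2,3) pos(1) by (cases "u = w") (auto intro: less_imp_le)
    then have "agree t (g u (c u (base x u))) (g u (x u))"
      unfolding off_def le_INF_iff agree_def by (auto simp: not_less[symmetric])
    then show ?thesis
      using agree_br[OF t(1) pos(1), of v] by (auto simp: agree_def)
  qed
  then have "rk u (br v x u) t \<le> enat (base x u)"
    by (rule rk_le)
  ultimately show False
    using pos_eq_baseI[OF assms(1-3) pos(1)] pos(2) by blast
qed

lemma codeD:
  assumes "code K w x = code K w x'"
  shows "u \<in> I3 \<Longrightarrow> pos K w x u = pos K w x' u"
    and "u \<in> I3 \<Longrightarrow> rk u (br w x u) (stop w x) < enat K \<longleftrightarrow> rk u (br w x' u) (stop w x') < enat K"
    and "val w x = val w x'"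
    and "u \<in> I3 \<Longrightarrow> lam K u (pos K w x u) (br w x u) = lam K u (pos K w x' u) (br w x' u)"
    and "u \<in> I3 \<Longrightarrow> v \<in> I3 \<Longrightarrow>
      off u (pos K w x u) (br w x u) < off v (pos K w x v) (br w x v) \<longleftrightarrow>
      off u (pos K w x' u) (br w x' u) < off v (pos K w x' v) (br w x' v)"
  using assms by (auto simp: code_def I3_def)

lemma lev_eq_stop_iff:
  assumes "0 < K"
  shows "lev K w x = stop w x \<longleftrightarrow> (\<forall>u\<in>I3. rk u (br w x u) (stop w x) < enat K)"
proof
  assume "lev K w x = stop w x"
  then show "\<forall>u\<in>I3. rk u (br w x u) (stop w x) < enat K"
    using lev_props(2)[OF assms, of _ w x] by auto
next
  assume "\<forall>u\<in>I3. rk u (br w x u) (stop w x) < enat K"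
  then show "lev K w x = stop w x"
    using lev_props(1)[OF assms, of w x] le_levI[of "stop w x" w x K] by auto
qed

text \<open>The earliest pair of each triple is right there, hence wrong about the other triple, and
  \<open>wrong_val_leaves_first\<close> tells which vertex leaves first in each. The recorded data
  rule out the resulting reversal. The second alternative in \<open>codes\<close> is meant for pairs
  whose codes have no limit.\<close>

lemma codes_determine_edge:
  assumes x: "x \<in> Pi I3 X" "generic K x" and x': "x' \<in> Pi I3 X" "generic K x'"
    and codes: "\<And>w. w \<in> I3 \<Longrightarrow> code K w x = code K w x' \<or>
      (\<exists>u\<in>I3. pos K w x u \<noteq> base x u) \<and> (\<exists>u\<in>I3. pos K w x' u \<noteq> base x' u)"
    and edge: "E x" "\<not> E x'"
  shows False
proof -
  obtain a where a: "a \<in> I3" "stop a x = nmin x" by (rule nmin_attained)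
  obtain b where b: "b \<in> I3" "stop b x' = nmin x'" by (rule nmin_attained)
  have "0 < K" using base_enat(2)[OF x(2) a(1)] by simp
  note A = stop_eq_nmin[OF x a] and B = stop_eq_nmin[OF x' b]
  have ca: "code K a x = code K a x'" and cb: "code K b x = code K b x'"
    using codes a b A(2) B(2) by blast+
  \<comment> \<open>Positions bound \<open>base\<close> from above, with equality for pair
    \<open>a\<close> in \<open>x\<close> and for pair \<open>b\<close> in \<open>x'\<close>; equal
    codes thus give both inequalities.\<close>
  have base: "base x' u = base x u" if "u \<in> I3" for u
    using A(2) B(2) codeD(1)[OF ca] codeD(1)[OF cb] base_le_pos[OF x b(1)] base_le_pos[OF x' a(1)] that
    by (metis antisym)
  have levs: "lev K a x' = stop a x'" "lev K b x = stop b x"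
    using A(1) B(1) codeD(2)[OF ca] codeD(2)[OF cb] \<open>0 < K\<close> by (auto simp: lev_eq_stop_iff)
  have pa: "pos K a x' u = base x' u" and pb: "pos K b x u = base x u" if "u \<in> I3" for u
    using A(2) B(2) codeD(1)[OF ca] codeD(1)[OF cb] base that by auto
  have vals: "val a x' \<noteq> E x'" "val b x \<noteq> E x"
    using A(3) B(3) codeD(3)[OF ca] codeD(3)[OF cb] edge by auto
  then have "a \<noteq> b" using B(3) by auto
  obtain t where t: "vanish x t" "off b (base x b) (g b (x b)) = enat t"
      "\<And>u. u \<in> I3 \<Longrightarrow> u \<noteq> b \<Longrightarrow> enat t < off u (base x u) (g u (x u))"
    using wrong_val_leaves_first[OF x b(1) pb levs(2) vals(2)] by blast
  obtain t' where t': "vanish x' t'" "off a (base x' a) (g a (x' a)) = enat t'"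
      "\<And>u. u \<in> I3 \<Longrightarrow> u \<noteq> a \<Longrightarrow> enat t' < off u (base x' u) (g u (x' u))"
    using wrong_val_leaves_first[OF x' a(1) pa levs(1) vals(1)] by blast
  \<comment> \<open>The two triples disagree on which of the coordinates \<open>a\<close> and
    \<open>b\<close> leaves its base landmark first.\<close>
  have first: "off b (base x b) (g b (x b)) < off a (base x a) (g a (x a))"
      "off a (base x a) (g a (x' a)) < off b (base x b) (g b (x' b))"
    using t t' a b \<open>a \<noteq> b\<close> base by auto
  have "\<exists>d\<in>I3. d \<noteq> a \<and> d \<noteq> b"
    by (simp add: I3_def) presburger
  then obtain d where d: "d \<in> I3" "d \<noteq> a" "d \<noteq> b" by blast
  show False
  proof (cases "\<forall>u\<in>I3. pos K d x u = base x u")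
    \<comment> \<open>The pair missing \<open>d\<close> contains both coordinates \<open>a\<close>
      and \<open>b\<close>, so its code records their order of departure.\<close>
    case True
    then have cd: "code K d x = code K d x'" using codes[OF d(1)] by blast
    show False
      using codeD(5)[OF cd b(1) a(1)] codeD(1)[OF cd] True first a b d
      by (simp add: br_other) 
  next
    case False
    then obtain u where u: "u \<in> I3" "pos K d x u \<noteq> base x u" by blast
    have "\<exists>u\<in>I3. pos K d x' u \<noteq> base x' u"
      using codes[OF d(1)] u codeD(1)[of K d x x'] base by auto
    then obtain u' where u': "u' \<in> I3" "pos K d x' u' \<noteq> base x' u'" by blast
    \<comment> \<open>Now both first departures lead to nodes with names below \<open>K\<close>. The
      code missing \<open>a\<close> sees coordinate \<open>b\<close> and the code missing
      \<open>b\<close> sees coordinate \<open>a\<close>, so each of the two departure levels is the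
      same in both triples, against \<open>first\<close>.\<close>
    have "lam K b (base x b) (g b (x b)) \<noteq> 0"
      using leaves_first_lam[OF x d(1) b(1) d(3) t u] .
    moreover have "lam K b (base x b) (g b (x b)) = lam K b (base x b) (g b (x' b))"
      using codeD(4)[OF ca b(1)] A(2) pa base b \<open>a \<noteq> b\<close> by (simp add: br_other)
    moreover have "lam K a (base x a) (g a (x' a)) \<noteq> 0"
      using leaves_first_lam[OF x' d(1) a(1) d(2) t' u'] base[OF a(1)] by simp
    moreover have "lam K a (base x a) (g a (x' a)) = lam K a (base x a) (g a (x a))"
      using codeD(4)[OF cb a(1)] B(2) pb base a \<open>a \<noteq> b\<close> by (simp add: br_other)
    ultimately show False
      using first lam_eq_imp_off_eq by (metis order_less_asym)
  qed
qed

end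

section \<open>Dependence on the pair alone, and the bad triples\<close>

context branching
begin

lemma third_cong: "(\<And>u. u \<in> I3 - {w} \<Longrightarrow> x u = x' u) \<Longrightarrow> third w x = third w x'"
  unfolding third_def by (intro ext arg_cong[where f = uminus] sum.cong) auto

lemma br_cong:
  assumes "\<And>u. u \<in> I3 - {w} \<Longrightarrow> x u = x' u" "u \<in> I3"
  shows "br w x u = br w x' u"
proof (cases "u = w")
  case True
  then show ?thesis using third_cong[OF assms(1)] by (simp add: br_def)
qed (use assms in \<open>simp add: br_def\<close>)

text \<open>This turns codes into data of pairs, so that prescribing a code defines an internal set
  in a product of two parts.\<close>

lemma code_cong:
  assumes E: "\<And>x x'. (\<And>u. u \<in> I3 \<Longrightarrow> x u = x' u) \<Longrightarrow> E x = E x'"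
    and xx: "\<And>u. u \<in> I3 - {w} \<Longrightarrow> x u = x' u"
  shows "code K w x = code K w x'"
proof -
  have upd: "E (x(w := z)) = E (x'(w := z))" for z
    using xx by (intro E) auto
  have thd: "third w x = third w x'" using third_cong[OF xx] .
  have br: "br w x u = br w x' u" if "u \<in> I3" for u using br_cong[OF xx that] .
  have "const w x = const w x'"
    by (simp add: const_def fun_eq_iff upd thd)
  then have stop: "stop w x = stop w x'"
    by (simp add: stop_def)
  have val: "val w x = val w x'"
    by (simp add: val_def upd thd stop)
  have lev: "lev K w x = lev K w x'"
    unfolding lev_def stop by (intro arg_cong[where f = Max]) (auto simp: br)
  have pos: "pos K w x u = pos K w x' u" if "u \<in> I3" for u
    using that by (simp add: pos_def lev br)
  have "set [1, 2, 3] \<subseteq> I3" by (auto simp: I3_def)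
  then show ?thesis
    unfolding code_def by (auto simp: pos br val stop subset_iff)
qed

text \<open>Unlike the failure of \<open>generic\<close>, this does not involve deciding levels.
  With the other two vertices fixed it only asks whether the vertex at \<open>u\<close> follows the
  third branch into a node that avoids the first \<open>K\<close> landmarks.\<close>

definition bad :: "nat \<Rightarrow> nat \<Rightarrow> (nat \<Rightarrow> 'a) \<Rightarrow> bool" where
  "bad K u x \<longleftrightarrow> (\<exists>n. vanish x n \<and> enat K \<le> rk u (third u x) n)"

lemma vanish_cong: "(\<And>u. u \<in> I3 \<Longrightarrow> x u = x' u) \<Longrightarrow> vanish x n = vanish x' n"
  unfolding vanish_def by (metis (no_types, lifting) sum.cong)

lemma bad_cong:
  assumes "\<And>u. u \<in> I3 \<Longrightarrow> x u = x' u"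
  shows "bad K u x = bad K u x'"
  unfolding bad_def using vanish_cong[OF assms] third_cong[of u x x'] assms by auto

text \<open>Given the other two vertices, a bad vertex lies in the first node of their third branch
  that avoids the first \<open>K\<close> landmarks.\<close>
lemma measure_bad_le:
  assumes u: "u \<in> I3" and sets: "sets M = Pow (X u)" and "finite (X u)" "finite_measure M"
    and net: "\<And>h n. (\<And>j. j < K \<Longrightarrow> \<not> agree n (g u (c u j)) h)
      \<Longrightarrow> measure M {z \<in> X u. agree n (g u z) h} \<le> \<delta>"
    and "0 \<le> \<delta>"
  shows "measure M {z \<in> X u. bad K u (y(u := z))} \<le> \<delta>"
proof -
  define h where "h = third u y"
  have thd: "third u (y(u := z)) = h" for z
    unfolding h_def by (rule third_cong) auto
  have bad: "bad K u (y(u := z)) \<longleftrightarrow> (\<exists>n. agree n (g u z) h \<and> enat K \<le> rk u h n)" for z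
    unfolding bad_def agree_third[OF u, symmetric] by (simp add: thd)
  show ?thesis
  proof (cases "\<exists>n. enat K \<le> rk u h n")
    case True
    define m where "m = (LEAST n. enat K \<le> rk u h n)"
    have m: "enat K \<le> rk u h m"
      unfolding m_def using True by (rule LeastI_ex)
    have "{z \<in> X u. bad K u (y(u := z))} \<subseteq> {z \<in> X u. agree m (g u z) h}"
      unfolding bad m_def by (auto intro: agree_mono Least_le)
    then have "measure M {z \<in> X u. bad K u (y(u := z))} \<le> measure M {z \<in> X u. agree m (g u z) h}"
      using assms by (intro finite_measure.finite_measure_mono) auto
    also have "\<dots> \<le> \<delta>"
      using m by (intro net) (simp add: rk_ge_iff)
    finally show ?thesis .
  next
    case False
    then show ?thesis using assms by (simp add: bad)
  qed
qed

end

text \<open>The witnessing level is \<open>nmin\<close>, where \<open>x u\<close> and the third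
  branch still share a node.\<close>

lemma (in decided_branching) not_generic_imp_bad:
  assumes "x \<in> Pi I3 X" "\<not> generic K x"
  obtains u where "u \<in> I3" "bad K u x"
proof -
  obtain u where u: "u \<in> I3" "enat K \<le> rk u (g u (x u)) (nmin x)"
    using assms(2) by (auto simp: generic_def not_less)
  have "agree (nmin x) (g u (x u)) (third u x)"
    using u(1) vanish_nmin[OF assms(1)] by (simp add: agree_third)
  then have "enat K \<le> rk u (third u x) (nmin x)"
    using u(2) by (simp add: rk_cong)
  then show thesis
    using that u(1) vanish_nmin[OF assms(1)] by (auto simp: bad_def)
qed

section \<open>From hypergraphs to decided branchings\<close>

lemma separating_level:
  fixes f :: "'a \<Rightarrow> nat \<Rightarrow> F3"
  assumes "finite A" "inj_on f A"
  obtains n where "\<And>x y. x \<in> A \<Longrightarrow> y \<in> A \<Longrightarrow> agree n (f x) (f y) \<Longrightarrow> x = y"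
proof -
  have "\<exists>m. x \<noteq> y \<longrightarrow> f x m \<noteq> f y m" if "x \<in> A" "y \<in> A" for x y
    using assms(2) that by (metis inj_onD ext)
  then obtain d where d: "\<And>x y. x \<in> A \<Longrightarrow> y \<in> A \<Longrightarrow> x \<noteq> y \<Longrightarrow> f x (d x y) \<noteq> f y (d x y)"
    by metis
  define n where "n = Suc (Max ((\<lambda>(x, y). d x y) ` (A \<times> A)))"
  have less: "d x y < n" if "x \<in> A" "y \<in> A" for x y
    unfolding n_def less_Suc_eq_le using assms(1) that by (intro Max_ge) auto
  then have "x = y" if "x \<in> A" "y \<in> A" "agree n (f x) (f y)" for x y
    using d[OF that(1,2)] less[OF that(1,2)] that by (auto simp: agree_def)
  then show thesis by (rule that)
qed

text \<open>Some pair has decided at the first nonvanishing level: otherwise every coordinate could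
  be replaced within its node so as to flip the relation, contrary to
  \<open>some_coordinate_irrelevant\<close>. If the triple always vanishes, any level at which a
  pair decides will do.\<close>

lemma decided_branching_hypergraph:
  fixes H :: "'a hypergraph3" and a :: "nat \<Rightarrow> 'a \<Rightarrow> rat"
  assumes fin: "finite_hypergraph3 H"
    and inj: "\<And>u. u \<in> I3 \<Longrightarrow> inj_on (g u) (part H u)"
    and gs: "\<And>x y z. x \<in> part H 1 \<Longrightarrow> y \<in> part H 2 \<Longrightarrow> z \<in> part H 3 \<Longrightarrow>
      (x, y, z) \<in> edges H \<longleftrightarrow> (g 1 x, g 2 y, g 3 z) \<in> edges GS3"
    and half: "\<And>x y z. x \<in> part H 1 \<Longrightarrow> y \<in> part H 2 \<Longrightarrow> z \<in> part H 3 \<Longrightarrow>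
      (x, y, z) \<in> edges H \<longleftrightarrow> a 1 x + a 2 y + a 3 z \<ge> 1"
  shows "decided_branching (part H) g (\<lambda>x. (x 1, x 2, x 3) \<in> edges H)"
proof -
  define E where "E = (\<lambda>x::nat \<Rightarrow> 'a. (x 1, x 2, x 3) \<in> edges H)"
  interpret branching "part H" g E undefined .
  have const: "\<exists>n. const w x n" if w: "w \<in> I3" for x w
  proof -
    have "finite (part H w)"
      using fin w by (auto simp: finite_hypergraph3_def I3_def)
    \<comment> \<open>At a separating level a node holds at most one vertex, so the pair has decided
      there.\<close>
    then obtain n where n: "\<And>x y. x \<in> part H w \<Longrightarrow> y \<in> part H w \<Longrightarrow> agree n (g w x) (g w y) \<Longrightarrow> x = y"
      using separating_level inj[OF w] by blast
    show ?thesis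
    proof (cases "\<exists>z\<in>part H w. agree n (g w z) (third w x)")
      case True
      then obtain z where z: "z \<in> part H w" "agree n (g w z) (third w x)" by blast
      have "z' = z" if "z' \<in> part H w" "agree n (g w z') (third w x)" for z'
        using n[OF that(1) z(1)] that(2) z(2) agree_sym agree_trans by metis
      then show ?thesis unfolding const_def by metis
    next
      case False
      then show ?thesis unfolding const_def by blast
    qed
  qed
  have "\<exists>w\<in>I3. \<exists>n. vanish x n \<and> const w x n" if x: "x \<in> Pi I3 (part H)" for x
  proof (cases "\<forall>n. vanish x n")
    case True
    then show ?thesis using const[of 1 x] by (auto simp: I3_def)
  next
    case False
    then have ex: "\<exists>n. (\<Sum>u\<in>I3. g u (x u) n) \<noteq> 0" by (auto simp: vanish_def)
    define n where "n = (LEAST n. (\<Sum>u\<in>I3. g u (x u) n) \<noteq> 0)"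
    have n: "(\<Sum>u\<in>I3. g u (x u) n) \<noteq> 0" unfolding n_def using ex by (rule LeastI_ex)
    have vn: "vanish x n"
      unfolding vanish_def n_def using not_less_Least by blast
    show ?thesis
    proof (rule ccontr)
      assume "\<not> ?thesis"
      with vn have "\<not> const w x n" if "w \<in> I3" for w using that by blast
      then have "\<exists>z. z \<in> part H w \<and> agree n (g w z) (third w x) \<and> E (x(w := z)) \<noteq> E x"
        if "w \<in> I3" for w using that unfolding const_def by metis
      then obtain z where z: "\<And>w. w \<in> I3 \<Longrightarrow> z w \<in> part H w"
        "\<And>w. w \<in> I3 \<Longrightarrow> agree n (g w (z w)) (third w x)" "\<And>w. w \<in> I3 \<Longrightarrow> E (x(w := z w)) \<noteq> E x"
        by metis
      have "agree n (g w (z w)) (g w (x w))" if "w \<in> I3" for w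
        using z(2)[OF that] agree_third[OF that] vn agree_sym agree_trans by metis
      then have agr: "agree n (g 1 (z 1)) (g 1 (x 1))" "agree n (g 2 (z 2)) (g 2 (x 2))"
          "agree n (g 3 (z 3)) (g 3 (x 3))"
        by (auto simp: I3_def)
      have p: "p \<in> part H u" if "p \<in> {x u, z u}" "u \<in> I3" for p u
        using that x z(1) by auto
      have I: "1 \<in> I3" "2 \<in> I3" "3 \<in> I3" by (auto simp: I3_def)
      have sum: "(\<Sum>u\<in>I3. g u (x u) m) = g 1 (x 1) m + g 2 (x 2) m + g 3 (x 3) m" for m
        by (simp add: I3_def add.assoc)
      have "((z 1, x 2, x 3) \<in> edges H) = ((x 1, x 2, x 3) \<in> edges H) \<or>
          ((x 1, z 2, x 3) \<in> edges H) = ((x 1, x 2, x 3) \<in> edges H) \<or>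
          ((x 1, x 2, z 3) \<in> edges H) = ((x 1, x 2, x 3) \<in> edges H)"
      proof (rule some_coordinate_irrelevant[where R = "\<lambda>p q r. (p, q, r) \<in> edges H"])
        fix p q r assume "p \<in> {x 1, z 1}" "q \<in> {x 2, z 2}" "r \<in> {x 3, z 3}"
        then have "p \<in> part H 1" "q \<in> part H 2" "r \<in> part H 3"
          using p I by blast+
        then show "(p, q, r) \<in> edges H \<longleftrightarrow> a 1 p + a 2 q + a 3 r \<ge> 1"
            "(p, q, r) \<in> edges H \<longleftrightarrow> (g 1 p, g 2 q, g 3 r) \<in> edges GS3"
          by (rule half, rule gs)
      qed (use vn n agr in \<open>simp_all add: vanish_def sum\<close>)
      then show False
        using z(3)[OF I(1)] z(3)[OF I(2)] z(3)[OF I(3)] by (simp add: E_def)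
    qed
  qed
  with const show ?thesis
    by (simp add: decided_branching_def E_def)
qed

section \<open>Landmarks and measures on finite products\<close>

text \<open>The nodes of measure above the threshold form a finite laminar family. Its minimal
  members are disjoint, so there are at most \<open>k + 1\<close> of them; every heavy node contains
  one, so a point chosen in each minimal member forms the net.\<close>

lemma exists_net:
  fixes f :: "'a \<Rightarrow> nat \<Rightarrow> F3"
  assumes "finite X" "prob_space M" "sets M = Pow X"
  obtains d :: "nat \<Rightarrow> 'a" where "\<And>h n. 1 / real (Suc k) < measure M {x \<in> X. agree n (f x) h} \<Longrightarrow>
    \<exists>l\<le>k. agree n (f (d l)) h"
proof -
  interpret prob_space M by fact
  define \<F> where "\<F> = {F. \<exists>n h. F = {x \<in> X. agree n (f x) h} \<and> 1 / real (Suc k) < measure M F}"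
  define \<M> where "\<M> = {F \<in> \<F>. \<forall>F'\<in>\<F>. F' \<subseteq> F \<longrightarrow> F = F'}"
  have "\<F> \<subseteq> Pow X" by (auto simp: \<F>_def)
  then have fin: "finite \<F>" using assms(1) by (meson finite_Pow_iff finite_subset)
  have "\<M> \<subseteq> \<F>" by (auto simp: \<M>_def)
  then have finM: "finite \<M>" using fin finite_subset by blast
  have ne: "F \<noteq> {}" if "F \<in> \<F>" for F
    using that by (auto simp: \<F>_def)
  have laminar: "F \<subseteq> F' \<or> F' \<subseteq> F" if F: "F \<in> \<F>" "F' \<in> \<F>" "F \<inter> F' \<noteq> {}" for F F'
  proof -
    obtain n h n' h' where "F = {x \<in> X. agree n (f x) h}" "F' = {x \<in> X. agree n' (f x) h'}"
      using F by (auto simp: \<F>_def)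
    with F(3) show ?thesis
      by (cases n n' rule: le_cases) (auto simp: agree_def)
  qed
  have "disjoint_family_on (\<lambda>F. F) \<M>"
    unfolding disjoint_family_on_def
  proof (intro ballI impI, rule ccontr)
    fix F F' assume F: "F \<in> \<M>" "F' \<in> \<M>" "F \<noteq> F'" "F \<inter> F' \<noteq> {}"
    with laminar[of F F'] show False by (auto simp: \<M>_def)
  qed
  then have "measure M (\<Union>F\<in>\<M>. F) = (\<Sum>F\<in>\<M>. measure M F)"
    using finM \<open>\<M> \<subseteq> \<F>\<close> \<open>\<F> \<subseteq> Pow X\<close> assms(3) by (intro finite_measure_finite_Union) auto
  moreover have "(\<Sum>F\<in>\<M>. 1 / real (Suc k)) \<le> (\<Sum>F\<in>\<M>. measure M F)"
    using \<open>\<M> \<subseteq> \<F>\<close> by (intro sum_mono) (auto simp: \<F>_def less_imp_le)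
  moreover have "(\<Sum>F\<in>\<M>. 1 / real (Suc k)) = real (card \<M>) / real (Suc k)"
    by simp
  ultimately have "real (card \<M>) / real (Suc k) \<le> 1"
    using prob_le_1[of "\<Union>F\<in>\<M>. F"] by linarith
  then have card: "card \<M> \<le> Suc k" by (simp add: field_simps)
  obtain e where e: "bij_betw e {0..<card \<M>} \<M>"
    using ex_bij_betw_nat_finite[OF finM] by blast
  define d where "d l = (SOME x. x \<in> e l)" for l
  show thesis
  proof
    fix h n assume "1 / real (Suc k) < measure M {x \<in> X. agree n (f x) h}"
    then have "{x \<in> X. agree n (f x) h} \<in> \<F>" by (auto simp: \<F>_def)
    then obtain F where F: "F \<in> \<M>" "F \<subseteq> {x \<in> X. agree n (f x) h}"
      using finite_has_minimal2[OF fin] unfolding \<M>_def by blast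
    then have "F \<in> e ` {0..<card \<M>}"
      using e by (auto simp: bij_betw_def)
    then obtain l where l: "l < card \<M>" "F = e l" by auto
    have "d l \<in> F"
      unfolding d_def l(2) some_in_eq using ne F(1) l(2) \<open>\<M> \<subseteq> \<F>\<close> by auto
    then show "\<exists>l\<le>k. agree n (f (d l)) h"
      using F l card by (intro exI[of _ l]) auto
  qed
qed

text \<open>Exceeds \<open>prod_encode (k, l)\<close> for all \<open>l\<close> up to
  \<open>k\<close>, so that the first \<open>net_size k\<close> landmarks include the whole net for
  threshold \<open>1 / (k + 1)\<close>.\<close>

definition net_size :: "nat \<Rightarrow> nat" where
  "net_size k = Suc (\<Sum>l\<le>k. prod_encode (k, l))"

text \<open>The pairing function interleaves the nets for all thresholds into one sequence.\<close>

lemma exists_landmarks: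
  fixes f :: "'a \<Rightarrow> nat \<Rightarrow> F3"
  assumes "finite X" "prob_space M" "sets M = Pow X"
  obtains c :: "nat \<Rightarrow> 'a" where
    "\<And>k h n. (\<And>j. j < net_size k \<Longrightarrow> \<not> agree n (f (c j)) h) \<Longrightarrow>
      measure M {x \<in> X. agree n (f x) h} \<le> 1 / real (Suc k)"
proof -
  have "\<exists>d. \<forall>h n. 1 / real (Suc k) < measure M {x \<in> X. agree n (f x) h} \<longrightarrow>
      (\<exists>l\<le>k. agree n (f (d l)) h)" for k
    using exists_net[OF assms, of k f] by metis
  then obtain d where d: "\<And>k h n. 1 / real (Suc k) < measure M {x \<in> X. agree n (f x) h} \<Longrightarrow>
      \<exists>l\<le>k. agree n (f (d k l)) h" by metis
  define c where "c j = (case prod_decode j of (k, l) \<Rightarrow> d k l)" for j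
  show thesis
  proof
    fix k h n assume no: "\<And>j. j < net_size k \<Longrightarrow> \<not> agree n (f (c j)) h"
    show "measure M {x \<in> X. agree n (f x) h} \<le> 1 / real (Suc k)"
    proof (rule ccontr)
      assume "\<not> ?thesis"
      then obtain l where l: "l \<le> k" "agree n (f (d k l)) h" using d[of k n h] by auto
      have "prod_encode (k, l) < net_size k"
        unfolding net_size_def less_Suc_eq_le using l(1) by (intro member_le_sum) auto
      then show False using no l(2) by (force simp: c_def)
    qed
  qed
qed

section \<open>Product measures of finite discrete spaces\<close>

lemma PiM_finite_discrete:
  assumes "finite I" "\<And>u. u \<in> I \<Longrightarrow> finite (X u) \<and> sets (M u) = Pow (X u)"
  shows "sets (PiM I M) = Pow (PiE I X)"
proof
  have sp: "space (M u) = X u" if "u \<in> I" for u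
    using sets_eq_imp_space_eq[of "M u" "count_space (X u)"] assms(2)[OF that] by simp
  then have "space (PiM I M) = PiE I X"
    by (simp add: space_PiM cong: PiE_cong)
  then show "sets (PiM I M) \<subseteq> Pow (PiE I X)"
    using sets.sets_into_space by blast
  show "Pow (PiE I X) \<subseteq> sets (PiM I M)"
  proof
    fix B assume B: "B \<in> Pow (PiE I X)"
    have "{x} \<in> sets (PiM I M)" if "x \<in> B" for x
    proof -
      have "{x} = PiE I (\<lambda>u. {x u})"
        using B that by (auto simp: PiE_iff intro!: PiE_singleton[symmetric])
      then show ?thesis
        using B that assms by (auto intro!: sets_PiM_I_finite simp: PiE_iff subset_iff)
    qed
    moreover have "finite B"
      using B assms by (auto intro: finite_subset[OF _ finite_PiE])
    ultimately have "(\<Union>x\<in>B. {x}) \<in> sets (PiM I M)"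
      by (intro sets.finite_UN) auto
    then show "B \<in> sets (PiM I M)" by simp
  qed
qed

text \<open>Fubini with coordinate \<open>u\<close> integrated first: a uniform bound on the slices
  bounds the whole set.\<close>

lemma measure_PiM_le:
  assumes I: "finite I" "u \<in> I" and "0 \<le> \<delta>"
    and M: "\<And>v. v \<in> I \<Longrightarrow> prob_space (M v) \<and> finite (X v) \<and> sets (M v) = Pow (X v)"
    and B: "B \<subseteq> PiE I X"
    and slice: "\<And>y. measure (M u) {z \<in> X u. y(u := z) \<in> B} \<le> \<delta>"
  shows "measure (PiM I M) B \<le> \<delta>"
proof -
  \<comment> \<open>The product locale asks for probability measures at all indices; outside
    \<open>I\<close> the measure \<open>M u\<close> is put in.\<close>
  define M' where "M' v = (if v \<in> I then M v else M u)" for v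
  have PiM: "PiM I M = PiM I M'"
    by (rule PiM_cong) (auto simp: M'_def)
  have pr: "prob_space (M' v)" for v using M I by (auto simp: M'_def)
  interpret product_prob_space M' using pr by (rule product_prob_spaceI)
  interpret slice: prob_space "M u" using M I by blast
  have ins: "insert u (I - {u}) = I" using I by auto
  have setsB: "B \<in> sets (PiM I M')"
    using B PiM_finite_discrete[of I X M] I M PiM by auto
  have spu: "space (M u) = X u"
    using sets_eq_imp_space_eq[of "M u" "count_space (X u)"] M I by simp
  have "emeasure (PiM I M') B = (\<integral>\<^sup>+ x. indicator B x \<partial>PiM (insert u (I - {u})) M')"
    unfolding ins using setsB by simp
  also have "\<dots> = (\<integral>\<^sup>+ y. (\<integral>\<^sup>+ z. indicator B (y(u := z)) \<partial>M' u) \<partial>PiM (I - {u}) M')"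
    using I setsB by (intro product_nn_integral_insert) (simp_all only: ins, auto)
  also have "\<dots> \<le> (\<integral>\<^sup>+ y. ennreal \<delta> \<partial>PiM (I - {u}) M')"
  proof (intro nn_integral_mono)
    fix y
    have "(\<integral>\<^sup>+ z. indicator B (y(u := z)) \<partial>M' u) = (\<integral>\<^sup>+ z. indicator {z \<in> X u. y(u := z) \<in> B} z \<partial>M u)"
      unfolding M'_def using I by (auto simp: spu indicator_def intro!: nn_integral_cong)
    also have "\<dots> = emeasure (M u) {z \<in> X u. y(u := z) \<in> B}"
      using M I by (intro nn_integral_indicator) auto
    also have "\<dots> \<le> ennreal \<delta>"
      using slice[of y] by (simp add: slice.emeasure_eq_measure ennreal_leI)
    finally show "(\<integral>\<^sup>+ z. indicator B (y(u := z)) \<partial>M' u) \<le> ennreal \<delta>" .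
  qed
  also have "\<dots> = ennreal \<delta>" by (simp add: prob_space.emeasure_space_1[OF prob_space_PiM[OF pr]])
  finally show ?thesis
    using \<open>0 \<le> \<delta>\<close> by (simp add: PiM finite_measure.emeasure_eq_measure[OF prob_space.finite_measure[OF prob_space_PiM[OF pr]]])
qed

section \<open>Ultralimits and Loeb null sets\<close>

locale ultra =
  fixes U :: "nat filter"
  assumes ultrafilter: "nonprincipal_ultrafilter U"
begin

lemma U_nontrivial: "U \<noteq> bot"
  using ultrafilter by (simp add: nonprincipal_ultrafilter_def)

lemma not_eventually_iff: "\<not> eventually P U \<longleftrightarrow> eventually (\<lambda>i. \<not> P i) U"
proof
  assume *: "eventually (\<lambda>i. \<not> P i) U"
  show "\<not> eventually P U"
  proof
    assume "eventually P U"
    with * have "eventually (\<lambda>i. False) U" by eventually_elim simp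
    then show False using U_nontrivial by (simp add: eventually_False)
  qed
next
  assume "\<not> eventually P U"
  then show "eventually (\<lambda>i. \<not> P i) U"
    using ultrafilter unfolding nonprincipal_ultrafilter_def by blast
qed

lemma eventually_finite_const:
  assumes "finite S" "eventually (\<lambda>i. f i \<in> S) U"
  obtains s where "s \<in> S" "eventually (\<lambda>i. f i = s) U"
proof -
  have "\<exists>s\<in>S. eventually (\<lambda>i. f i = s) U"
  proof (rule ccontr)
    assume "\<not> ?thesis"
    then have "eventually (\<lambda>i. \<forall>s\<in>S. f i \<noteq> s) U"
      using assms(1) by (intro eventually_ball_finite) (auto simp: not_eventually_iff)
    with assms(2) have "eventually (\<lambda>i. False) U"
      by eventually_elim auto
    then show False using U_nontrivial by (simp add: eventually_False)
  qed
  then show thesis using that by blast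
qed

text \<open>\<open>Lim\<close> is a definite description, so a limit has to exist first: compactness
  gives a cluster point of \<open>f\<close>, and along an ultrafilter a cluster point is a
  limit.\<close>

lemma Lim_bounded:
  fixes f :: "nat \<Rightarrow> real"
  assumes "\<And>i. 0 \<le> f i" "\<And>i. f i \<le> b"
  shows "Lim U f \<le> b"
proof -
  have "filtermap f U \<noteq> bot"
    using U_nontrivial by (simp add: filtermap_bot_iff)
  moreover have "eventually (\<lambda>x. x \<in> {0..b}) (filtermap f U)"
    using assms by (simp add: eventually_filtermap)
  ultimately obtain l where l: "l \<in> {0..b}" "inf (nhds l) (filtermap f U) \<noteq> bot"
    using compact_Icc[of 0 b] unfolding compact_filter by blast
  have "(f \<longlongrightarrow> l) U"
  proof (rule topological_tendstoI, rule ccontr)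
    fix S assume S: "open S" "l \<in> S" "\<not> eventually (\<lambda>i. f i \<in> S) U"
    have "eventually (\<lambda>x. x \<in> S) (nhds l)"
      using S by (auto simp: eventually_nhds)
    moreover have "eventually (\<lambda>x. x \<notin> S) (filtermap f U)"
      using S(3) by (simp add: eventually_filtermap not_eventually_iff)
    ultimately have "eventually (\<lambda>x. False) (inf (nhds l) (filtermap f U))"
      unfolding eventually_inf by blast
    with l(2) show False by simp
  qed
  then have "Lim U f = l"
    by (rule tendsto_Lim[OF U_nontrivial])
  with l(1) show ?thesis by simp
qed

end

section \<open>Internal sets, the Loeb measure and representatives\<close>

lemma internal_set_subset: "internal_set U X e Y \<subseteq> ultra_space U X e"
  unfolding internal_set_def by (rule Collect_restrict)

lemma internal_image_subset: "internal_set U X e ` \<Y> \<subseteq> Pow (ultra_space U X e)"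
  using internal_set_subset by blast

lemma space_loeb [simp]: "space (loeb_measure U X M e) = ultra_space U X e"
  unfolding loeb_measure_def by (rule space_extend_measure[OF internal_image_subset])

lemma internal_set_in_loeb:
  assumes "\<And>i. Y i \<subseteq> PiE e (\<lambda>u. X u i)"
  shows "internal_set U X e Y \<in> sets (loeb_measure U X M e)"
  unfolding loeb_measure_def sets_extend_measure[OF internal_image_subset]
  using assms by (intro sigma_sets.Basic) auto

text \<open>If the extension in the definition of the Loeb measure did not exist, the measure would be
  zero, so the upper bound needs no extension theorem.\<close>
lemma emeasure_loeb_le:
  assumes "\<And>i. Y i \<subseteq> PiE e (\<lambda>u. X u i)"
  shows "emeasure (loeb_measure U X M e) (internal_set U X e Y)
    \<le> ennreal (Lim U (\<lambda>i. measure (PiM e (\<lambda>u. M u i)) (Y i)))"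
proof -
  define \<Y> where "\<Y> = {Y. \<forall>i. Y i \<subseteq> PiE e (\<lambda>u. X u i)}"
  define m where "m Y = ennreal (Lim U (\<lambda>i. measure (PiM e (\<lambda>u. M u i)) (Y i)))" for Y :: "nat \<Rightarrow> (nat \<Rightarrow> 'a) set"
  define \<Omega> where "\<Omega> = ultra_space U X e"
  define G where "G = internal_set U X e"
  have sub: "G ` \<Y> \<subseteq> Pow \<Omega>"
    unfolding G_def \<Omega>_def by (rule internal_image_subset)
  have Y: "Y \<in> \<Y>" using assms by (simp add: \<Y>_def)
  have L: "loeb_measure U X M e = extend_measure \<Omega> \<Y> G m"
    unfolding loeb_measure_def \<Y>_def m_def \<Omega>_def G_def ..
  have sets: "sets (loeb_measure U X M e) = sigma_sets \<Omega> (G ` \<Y>)"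
    unfolding L by (rule sets_extend_measure[OF sub])
  show ?thesis
  proof (cases "\<exists>\<mu>'. (\<forall>i\<in>\<Y>. \<mu>' (G i) = m i) \<and> measure_space \<Omega> (sigma_sets \<Omega> (G`\<Y>)) \<mu>'")
    case True
    then obtain \<mu>' where \<mu>': "\<And>i. i \<in> \<Y> \<Longrightarrow> \<mu>' (G i) = m i"
      "measure_space \<Omega> (sigma_sets \<Omega> (G`\<Y>)) \<mu>'" by blast
    have "emeasure (loeb_measure U X M e) (G Y) = m Y"
    proof (rule emeasure_extend_measure[OF L _ sub _ _ Y])
      show "positive (sets (loeb_measure U X M e)) \<mu>'" "countably_additive (sets (loeb_measure U X M e)) \<mu>'"
        using \<mu>'(2) unfolding sets measure_space_def by simp_all
    qed (rule \<mu>'(1))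
    then show ?thesis by (simp add: m_def G_def)
  next
    case False
    then have "loeb_measure U X M e = measure_of \<Omega> (G ` \<Y>) (\<lambda>_. 0)"
      unfolding L extend_measure_def by auto
    then have "emeasure (loeb_measure U X M e) (G Y) = 0"
      by (auto simp: emeasure_measure_of_conv)
    then show ?thesis by (simp add: G_def)
  qed
qed

lemma ultraproductE:
  assumes "C \<in> ultraproduct U X"
  obtains a where "a \<in> Pi UNIV X" "C = {y \<in> Pi UNIV X. eventually (\<lambda>i. a i = y i) U}"
proof -
  obtain a where "a \<in> Pi UNIV X" "C = ultra_rel U X `` {a}"
    using assms unfolding ultraproduct_def by (elim quotientE)
  then show thesis
    using that by (auto simp: ultra_rel_def)
qed

lemma ultraproduct_nonempty:
  assumes "C \<in> ultraproduct U X"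
  obtains y where "y \<in> C"
proof -
  obtain a where "a \<in> Pi UNIV X" "C = {y \<in> Pi UNIV X. eventually (\<lambda>i. a i = y i) U}"
    using assms by (rule ultraproductE)
  then have "a \<in> C" by simp
  then show thesis by (rule that)
qed

lemma ultraproduct_memberD: "C \<in> ultraproduct U X \<Longrightarrow> y \<in> C \<Longrightarrow> y i \<in> X i"
  by (erule ultraproductE) auto

lemma ultraproduct_eventually_eq:
  assumes "C \<in> ultraproduct U X" "y \<in> C" "y' \<in> C"
  shows "eventually (\<lambda>i. y i = y' i) U"
proof -
  obtain a where "eventually (\<lambda>i. a i = y i) U" "eventually (\<lambda>i. a i = y' i) U"
    using assms by (auto elim: ultraproductE)
  then show ?thesis by eventually_elim simp
qed

lemma eventually_restrict_eq:
  assumes "finite e" "x \<in> ultra_space U X e" "\<And>u. u \<in> e \<Longrightarrow> y u \<in> x u" "\<And>u. u \<in> e \<Longrightarrow> y' u \<in> x u"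
  shows "eventually (\<lambda>i. (\<lambda>u\<in>e. y u i) = (\<lambda>u\<in>e. y' u i)) U"
proof -
  have "eventually (\<lambda>i. \<forall>u\<in>e. y u i = y' u i) U"
    using assms by (intro eventually_ball_finite) (auto simp: PiE_iff intro: ultraproduct_eventually_eq)
  then show ?thesis by eventually_elim (auto simp: restrict_def)
qed

lemma internal_set_iff:
  assumes "finite e" "x \<in> ultra_space U X e" "\<And>u. u \<in> e \<Longrightarrow> y u \<in> x u"
  shows "x \<in> internal_set U X e Y \<longleftrightarrow> eventually (\<lambda>i. (\<lambda>u\<in>e. y u i) \<in> Y i) U"
proof
  assume "x \<in> internal_set U X e Y"
  then obtain y' where y': "\<And>u. u \<in> e \<Longrightarrow> y' u \<in> x u" "eventually (\<lambda>i. (\<lambda>u\<in>e. y' u i) \<in> Y i) U"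
    by (auto simp: internal_set_def)
  have "eventually (\<lambda>i. (\<lambda>u\<in>e. y u i) = (\<lambda>u\<in>e. y' u i)) U"
    using assms y'(1) by (rule eventually_restrict_eq)
  with y'(2) show "eventually (\<lambda>i. (\<lambda>u\<in>e. y u i) \<in> Y i) U"
    by eventually_elim simp
qed (use assms in \<open>auto simp: internal_set_def\<close>)

section \<open>Null sets and limits in the ultraproduct\<close>

context ultra
begin

lemma null_Inter_internal:
  assumes sub: "\<And>k i. Y k i \<subseteq> PiE e (\<lambda>u. X u i)"
    and le: "\<And>k i. measure (PiM e (\<lambda>u. M u i)) (Y k i) \<le> C / real (Suc k)"
  shows "(\<Inter>k. internal_set U X e (Y k)) \<in> null_sets (loeb_measure U X M e)"
proof -
  let ?L = "loeb_measure U X M e" and ?N = "\<Inter>k. internal_set U X e (Y k)"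
  have meas: "internal_set U X e (Y k) \<in> sets ?L" for k
    using sub by (rule internal_set_in_loeb)
  have "emeasure ?L ?N \<le> ennreal (C / real (Suc k))" for k
  proof -
    have "emeasure ?L ?N \<le> emeasure ?L (internal_set U X e (Y k))"
      using meas by (intro emeasure_mono) auto
    also have "\<dots> \<le> ennreal (Lim U (\<lambda>i. measure (PiM e (\<lambda>u. M u i)) (Y k i)))"
      using sub by (rule emeasure_loeb_le)
    also have "\<dots> \<le> ennreal (C / real (Suc k))"
      using le by (intro ennreal_leI Lim_bounded) auto
    finally show ?thesis .
  qed
  moreover have "(\<lambda>k. ennreal (C / real (Suc k))) \<longlonglongrightarrow> ennreal 0"
    by (intro tendsto_ennrealI) real_asymp
  ultimately have "emeasure ?L ?N \<le> ennreal 0"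
    using LIMSEQ_le_const by blast
  moreover have "?N \<in> sets ?L"
    using meas by (intro sets.countable_INT) auto
  ultimately show ?thesis by (auto simp: null_sets_def)
qed

lemma ultra_fun_of_bool:
  assumes x: "x \<in> ultra_space U X {1..k}" and y: "\<And>u. u \<in> {1..k} \<Longrightarrow> y u \<in> x u"
  shows "ultra_fun k U (\<lambda>i p. of_bool (E i p)) x =
    of_bool (eventually (\<lambda>i. E i (\<lambda>u\<in>{1..k}. y u i)) U)"
proof -
  define b where "b = (of_bool (eventually (\<lambda>i. E i (\<lambda>u\<in>{1..k}. y u i)) U) :: real)"
  have ev: "eventually (\<lambda>i. of_bool (E i (\<lambda>u\<in>{1..k}. y u i)) = b) U"
  proof (cases "eventually (\<lambda>i. E i (\<lambda>u\<in>{1..k}. y u i)) U")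
    case False
    then show ?thesis by (simp add: b_def not_eventually_iff)
  qed (auto simp: b_def elim: eventually_mono)
  have "{q \<in> \<rat>. \<exists>y. (\<forall>u\<in>{1..k}. y u \<in> x u) \<and>
      eventually (\<lambda>i. of_bool (E i (\<lambda>u\<in>{1..k}. y u i)) < q) U} = {q \<in> \<rat>. b < q}"
  proof (intro Collect_cong conj_cong refl iffI)
    fix q :: real assume "b < q"
    then have "eventually (\<lambda>i. of_bool (E i (\<lambda>u\<in>{1..k}. y u i)) < q) U"
      using ev by (auto elim: eventually_mono)
    with y show "\<exists>y. (\<forall>u\<in>{1..k}. y u \<in> x u) \<and>
        eventually (\<lambda>i. of_bool (E i (\<lambda>u\<in>{1..k}. y u i)) < q) U" by blast
  next
    fix q :: real assume "\<exists>y. (\<forall>u\<in>{1..k}. y u \<in> x u) \<and>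
        eventually (\<lambda>i. of_bool (E i (\<lambda>u\<in>{1..k}. y u i)) < q) U"
    then obtain y' where y': "\<And>u. u \<in> {1..k} \<Longrightarrow> y' u \<in> x u"
        "eventually (\<lambda>i. of_bool (E i (\<lambda>u\<in>{1..k}. y' u i)) < q) U" by blast
    have "eventually (\<lambda>i. (\<lambda>u\<in>{1..k}. y u i) = (\<lambda>u\<in>{1..k}. y' u i)) U"
      using finite_atLeastAtMost x y y'(1) by (rule eventually_restrict_eq)
    with y'(2) ev have "eventually (\<lambda>i. b < q) U"
      by eventually_elim simp
    then show "b < q" using U_nontrivial by (simp add: eventually_const)
  qed
  moreover have "Inf {q \<in> \<rat>. b < q} = b"
  proof (rule cInf_eq_non_empty)
    obtain q where "q \<in> \<rat>" "b < q" using Rats_dense_in_real[of b "b + 1"] by auto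
    then show "{q \<in> \<rat>. b < q} \<noteq> {}" by blast
    show "c \<le> b" if "\<And>q. q \<in> {q \<in> \<rat>. b < q} \<Longrightarrow> c \<le> q" for c
    proof (rule ccontr)
      assume "\<not> c \<le> b"
      then obtain q where "q \<in> \<rat>" "b < q" "q < c" using Rats_dense_in_real[of b c] by auto
      with that[of q] show False by simp
    qed
  qed auto
  ultimately show ?thesis unfolding ultra_fun_def b_def by simp
qed

text \<open>An iterated limit: along \<open>U\<close> for a fixed cutoff \<open>K\<close>, then with
  \<open>K\<close> tending to infinity. In this order a rank that is unbounded along
  \<open>U\<close> is simply one that is always cut off.\<close>

definition stab :: "(nat \<Rightarrow> nat \<Rightarrow> 'b) \<Rightarrow> bool" where
  "stab F \<longleftrightarrow> (\<exists>s. \<forall>\<^sub>F K in sequentially. \<forall>\<^sub>F i in U. F K i = s)"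

lemma stab_cong:
  assumes "\<forall>\<^sub>F K in sequentially. \<forall>\<^sub>F i in U. F K i = G K i" "stab G"
  shows "stab F"
proof -
  obtain s where "\<forall>\<^sub>F K in sequentially. \<forall>\<^sub>F i in U. G K i = s"
    using assms(2) by (auto simp: stab_def)
  with assms(1) have "\<forall>\<^sub>F K in sequentially. \<forall>\<^sub>F i in U. F K i = s"
  proof eventually_elim
    case (elim K)
    then show ?case by eventually_elim simp
  qed
  then show ?thesis by (auto simp: stab_def)
qed

lemma stab_map2:
  assumes "stab F" "stab G"
  shows "stab (\<lambda>K i. f (F K i) (G K i))"
proof -
  obtain s t where "\<forall>\<^sub>F K in sequentially. \<forall>\<^sub>F i in U. F K i = s"
      "\<forall>\<^sub>F K in sequentially. \<forall>\<^sub>F i in U. G K i = t"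
    using assms by (auto simp: stab_def)
  then have "\<forall>\<^sub>F K in sequentially. \<forall>\<^sub>F i in U. f (F K i) (G K i) = f s t"
  proof eventually_elim
    case (elim K)
    then show ?case by eventually_elim simp
  qed
  then show ?thesis by (auto simp: stab_def)
qed

lemma stab_const: "stab (\<lambda>K i. s)"
  unfolding stab_def by (intro exI[of _ s]) simp

lemma stab_map: "(\<And>a. a \<in> set as \<Longrightarrow> stab (F a)) \<Longrightarrow> stab (\<lambda>K i. map (\<lambda>a. F a K i) as)"
proof (induction as)
  case (Cons a as)
  then show ?case
    using stab_map2[of "F a" "\<lambda>K i. map (\<lambda>a. F a K i) as" Cons] by simp
qed (simp add: stab_const)

lemma stab_bool: "stab (\<lambda>K i. P i)" for P :: "nat \<Rightarrow> bool"
proof -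
  obtain s where "eventually (\<lambda>i. P i = s) U"
    using eventually_finite_const[of UNIV P] by auto
  then show ?thesis by (auto simp: stab_def)
qed

text \<open>Either \<open>a\<close> is bounded along \<open>U\<close>, hence constant there and
  below all large cutoffs, or it is at least every fixed cutoff along \<open>U\<close> and the
  default \<open>d\<close> is taken each time.\<close>

lemma stab_cutoff: "stab (\<lambda>K i. if a i < enat K then f (a i) else d)"
proof (cases "\<exists>K. eventually (\<lambda>i. a i < enat K) U")
  case True
  then obtain K where K: "eventually (\<lambda>i. a i < enat K) U" by blast
  then have "eventually (\<lambda>i. a i \<in> enat ` {..<K}) U"
    by (rule eventually_mono) (auto dest: less_enatD)
  then obtain s where s: "eventually (\<lambda>i. a i = s) U"
    using eventually_finite_const[of "enat ` {..<K}" a] by auto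
  have "\<forall>\<^sub>F i in U. (if a i < enat K' then f (a i) else d) = f s" if "K \<le> K'" for K'
    using K s
  proof eventually_elim
    case (elim i)
    moreover have "enat K \<le> enat K'" using that by simp
    ultimately show ?case using less_le_trans by fastforce
  qed
  then show ?thesis
    unfolding stab_def by (intro exI[of _ "f s"] eventually_sequentiallyI[of K])
next
  case False
  then have none: "\<forall>\<^sub>F i in U. \<not> a i < enat K" for K by (simp add: not_eventually_iff)
  have "\<forall>\<^sub>F i in U. (if a i < enat K then f (a i) else d) = d" for K
    using none[of K] by (rule eventually_mono) simp
  then show ?thesis
    unfolding stab_def by (intro exI[of _ d] eventually_sequentiallyI[of 0])
qed

end

section \<open>Types of pairs in the ultraproduct\<close>

locale ultra_branching = ultra U for U +
  fixes X :: "nat \<Rightarrow> nat \<Rightarrow> 'a set" and g :: "nat \<Rightarrow> nat \<Rightarrow> 'a \<Rightarrow> nat \<Rightarrow> F3"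
    and E :: "nat \<Rightarrow> (nat \<Rightarrow> 'a) \<Rightarrow> bool" and c :: "nat \<Rightarrow> nat \<Rightarrow> nat \<Rightarrow> 'a"
  assumes decided_i: "\<And>i. decided_branching (\<lambda>u. X u i) (g i) (E i)"
    and E_cong: "\<And>i x x'. (\<And>u. u \<in> I3 \<Longrightarrow> x u = x' u) \<Longrightarrow> E i x = E i x'"
begin

sublocale B: decided_branching "\<lambda>u. X u i" "g i" "E i" "c i" for i
  by (rule decided_i)

definition pt :: "(nat \<Rightarrow> nat \<Rightarrow> 'a) \<Rightarrow> nat \<Rightarrow> nat \<Rightarrow> 'a" where
  "pt y i u = y u i"

text \<open>A type is the limit of the codes, made a number because the classes of the partition are
  indexed by numbers. A pair may have no type.\<close>

definition has_type :: "nat \<Rightarrow> nat \<Rightarrow> (nat \<Rightarrow> nat \<Rightarrow> 'a) \<Rightarrow> bool" where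
  "has_type w s y \<longleftrightarrow> (\<forall>\<^sub>F K in sequentially. \<forall>\<^sub>F i in U. to_nat (B.code i K w (pt y i)) = s)"

definition ultra_generic :: "(nat \<Rightarrow> nat \<Rightarrow> 'a) \<Rightarrow> bool" where
  "ultra_generic y \<longleftrightarrow> (\<exists>K. \<forall>\<^sub>F i in U. B.generic i K (pt y i))"

definition points :: "(nat \<Rightarrow> nat \<Rightarrow> 'a) set" where
  "points = {y. \<forall>u\<in>I3. \<forall>i. y u i \<in> X u i}"

lemma pt_in: "y \<in> points \<Longrightarrow> pt y i \<in> Pi I3 (\<lambda>u. X u i)"
  by (auto simp: points_def pt_def)

text \<open>Once the positions are frozen at \<open>p\<close>, the rank bits and the numbers
  \<open>lam\<close> are cutoffs of quantities independent of \<open>K\<close>, and the other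
  entries are truth values independent of \<open>K\<close>.\<close>

lemma stab_code:
  assumes "\<And>u. u \<in> I3 \<Longrightarrow> \<forall>\<^sub>F K in sequentially. \<forall>\<^sub>F i in U. B.pos i K w (pt y i) u = p u"
  shows "stab (\<lambda>K i. B.code i K w (pt y i))"
proof -
  define h where "h u i = B.br i w (pt y i) u" for u i
  define st where "st i = B.stop i w (pt y i)" for i
  have mem: "u \<in> I3" if "u \<in> set [1, 2, 3]" for u
    using that by (auto simp: I3_def)
  have pos: "stab (\<lambda>K i. B.pos i K w (pt y i) u)" if "u \<in> set [1, 2, 3]" for u
    using assms[OF mem[OF that]] by (auto simp: stab_def)
  have rel: "stab (\<lambda>K i. B.rk i u (h u i) (st i) < enat K)" for u
  proof (rule stab_cong)
    show "stab (\<lambda>K i. if B.rk i u (h u i) (st i) < enat K then True else False)"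
      by (rule stab_cutoff)
  qed simp
  have lam: "stab (\<lambda>K i. B.lam i K u (B.pos i K w (pt y i) u) (h u i))" if "u \<in> set [1, 2, 3]" for u
  proof (rule stab_cong)
    show "stab (\<lambda>K i. B.lam i K u (p u) (h u i))"
      unfolding B.lam_def by (rule stab_cutoff)
    show "\<forall>\<^sub>F K in sequentially. \<forall>\<^sub>F i in U.
        B.lam i K u (B.pos i K w (pt y i) u) (h u i) = B.lam i K u (p u) (h u i)"
      using assms[OF mem[OF that]]
    proof eventually_elim
      case (elim K)
      then show ?case by eventually_elim simp
    qed
  qed
  have bit: "stab (\<lambda>K i. case a of (u, v) \<Rightarrow>
        B.off i u (B.pos i K w (pt y i) u) (h u i) < B.off i v (B.pos i K w (pt y i) v) (h v i))"
    if a: "a \<in> set (List.product [1, 2, 3] [1, 2, 3])" for a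
  proof -
    obtain u v where uv: "a = (u, v)" "u \<in> I3" "v \<in> I3"
      using a by (auto simp: I3_def)
    show ?thesis
    proof (rule stab_cong)
      show "stab (\<lambda>K i. B.off i u (p u) (h u i) < B.off i v (p v) (h v i))"
        by (rule stab_bool)
      show "\<forall>\<^sub>F K in sequentially. \<forall>\<^sub>F i in U. (case a of (u, v) \<Rightarrow>
        B.off i u (B.pos i K w (pt y i) u) (h u i) < B.off i v (B.pos i K w (pt y i) v) (h v i)) =
        (B.off i u (p u) (h u i) < B.off i v (p v) (h v i))"
        using assms[OF uv(2)] assms[OF uv(3)]
      proof eventually_elim
        case (elim K)
        then show ?case by eventually_elim (simp add: uv(1))
      qed
    qed
  qed
  show ?thesis
    unfolding B.code_def h_def[symmetric] st_def[symmetric]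
    apply (rule stab_map2[where f = Pair])
     apply (rule stab_map, erule pos)
    apply (rule stab_map2[where f = Pair])
     apply (rule stab_map, rule rel)
    apply (rule stab_map2[where f = Pair])
     apply (rule stab_bool)
    apply (rule stab_map2[where f = Pair])
     apply (rule stab_map, erule lam)
    apply (rule stab_map, erule bit)
    done
qed

lemma base_limit:
  assumes "y \<in> points" "ultra_generic y"
  obtains p where "\<And>u. u \<in> I3 \<Longrightarrow> \<forall>\<^sub>F i in U. B.base i (pt y i) u = p u"
proof -
  obtain K where K: "\<forall>\<^sub>F i in U. B.generic i K (pt y i)"
    using assms(2) by (auto simp: ultra_generic_def)
  have "\<exists>p. \<forall>\<^sub>F i in U. B.base i (pt y i) u = p" if "u \<in> I3" for u
  proof -
    have "\<forall>\<^sub>F i in U. B.base i (pt y i) u \<in> {..<K}"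
      using K
    proof eventually_elim
      case (elim i)
      then show ?case using B.base_enat(2)[OF elim that] by simp
    qed
    with finite_lessThan obtain p where "\<forall>\<^sub>F i in U. B.base i (pt y i) u = p"
      by (rule eventually_finite_const)
    then show ?thesis by (rule exI)
  qed
  then obtain p where "\<forall>u\<in>I3. \<forall>\<^sub>F i in U. B.base i (pt y i) u = p u"
    using bchoice[of I3 "\<lambda>u p. \<forall>\<^sub>F i in U. B.base i (pt y i) u = p"] by auto
  then show thesis by (intro that) (erule bspec)
qed

text \<open>Contrapositive: if the positions equal the base for arbitrarily large cutoffs, then by
  \<open>pos_eq_base_mono\<close> they do so for all large ones. Base ranks are bounded along
  \<open>U\<close>, so the positions stabilise and with them the code.\<close>

lemma no_type_imp_pos_neq_base:
  assumes y: "y \<in> points" "ultra_generic y" and w: "w \<in> I3" and no: "\<And>s. \<not> has_type w s y"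
  shows "\<forall>\<^sub>F K in sequentially. \<forall>\<^sub>F i in U. \<exists>u\<in>I3. B.pos i K w (pt y i) u \<noteq> B.base i (pt y i) u"
proof (rule ccontr)
  assume neg: "\<not> ?thesis"
  obtain K0 where K0: "\<forall>\<^sub>F i in U. B.generic i K0 (pt y i)"
    using y(2) by (auto simp: ultra_generic_def)
  obtain p where p: "\<And>u. u \<in> I3 \<Longrightarrow> \<forall>\<^sub>F i in U. B.base i (pt y i) u = p u"
    using base_limit[OF y] by blast
  have pos: "\<forall>\<^sub>F i in U. \<forall>u\<in>I3. B.pos i K w (pt y i) u = B.base i (pt y i) u" if "K0 \<le> K" for K
  proof -
    obtain K' where K': "K \<le> K'" "\<not> (\<forall>\<^sub>F i in U. \<exists>u\<in>I3. B.pos i K' w (pt y i) u \<noteq> B.base i (pt y i) u)"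
      using neg unfolding eventually_sequentially by blast
    have "\<forall>\<^sub>F i in U. \<forall>u\<in>I3. B.pos i K' w (pt y i) u = B.base i (pt y i) u"
      using K'(2) by (simp add: not_eventually_iff)
    with K0 show ?thesis
    proof eventually_elim
      case (elim i)
      then show ?case
        using B.pos_eq_base_mono[OF pt_in[OF y(1)] B.generic_mono[OF _ that] w _ K'(1)] by blast
    qed
  qed
  have "\<forall>\<^sub>F K in sequentially. \<forall>\<^sub>F i in U. B.pos i K w (pt y i) u = p u" if u: "u \<in> I3" for u
  proof (rule eventually_sequentiallyI)
    fix K assume "K0 \<le> K"
    from pos[OF this] p[OF u] show "\<forall>\<^sub>F i in U. B.pos i K w (pt y i) u = p u"
      by eventually_elim (use u in auto)
  qed
  then have "stab (\<lambda>K i. B.code i K w (pt y i))" by (rule stab_code)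
  then have "stab (\<lambda>K i. to_nat (B.code i K w (pt y i)))"
    by (rule stab_map2[OF _ stab_const, where f = "\<lambda>a b. to_nat a"])
  then obtain s where "has_type w s y"
    unfolding stab_def has_type_def by (elim exE)
  then show False using no by contradiction
qed

text \<open>For a large enough cutoff the hypotheses of \<open>codes_determine_edge\<close> hold at
  \<open>U\<close>-many stages, while a single stage is already contradictory.\<close>

lemma types_determine_edge:
  assumes y: "y \<in> points" "ultra_generic y" and y': "y' \<in> points" "ultra_generic y'"
    and types: "\<And>w s. w \<in> I3 \<Longrightarrow> has_type w s y \<longleftrightarrow> has_type w s y'"
    and E: "\<forall>\<^sub>F i in U. E i (pt y i)" "\<forall>\<^sub>F i in U. \<not> E i (pt y' i)"
  shows False
proof -
  \<comment> \<open>Pairs with a common type satisfy the first alternative, pairs without type the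
    second.\<close>
  define Q where "Q K w i \<longleftrightarrow> B.code i K w (pt y i) = B.code i K w (pt y' i) \<or>
      (\<exists>u\<in>I3. B.pos i K w (pt y i) u \<noteq> B.base i (pt y i) u) \<and>
      (\<exists>u\<in>I3. B.pos i K w (pt y' i) u \<noteq> B.base i (pt y' i) u)" for K w i
  have Q: "\<forall>\<^sub>F K in sequentially. \<forall>\<^sub>F i in U. Q K w i" if w: "w \<in> I3" for w
  proof (cases "\<exists>s. has_type w s y")
    case True
    then obtain s where "has_type w s y" "has_type w s y'" using types[OF w] by blast
    then show ?thesis
      unfolding has_type_def
    proof eventually_elim
      case (elim K)
      then show ?case
      proof eventually_elim
        case (elim i)
        then have "to_nat (B.code i K w (pt y i)) = to_nat (B.code i K w (pt y' i))" by simp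
        then show ?case unfolding Q_def by (auto dest: injD[OF inj_to_nat])
      qed
    qed
  next
    case False
    then have "\<And>s. \<not> has_type w s y" "\<And>s. \<not> has_type w s y'" using types[OF w] by auto
    from no_type_imp_pos_neq_base[OF y w this(1)] no_type_imp_pos_neq_base[OF y' w this(2)]
    show ?thesis
    proof eventually_elim
      case (elim K)
      then show ?case by eventually_elim (auto simp: Q_def)
    qed
  qed
  then have "\<forall>\<^sub>F K in sequentially. \<forall>w\<in>I3. \<forall>\<^sub>F i in U. Q K w i"
    by (intro eventually_ball_finite) auto
  then obtain K1 where "\<And>K. K \<ge> K1 \<Longrightarrow> \<forall>w\<in>I3. \<forall>\<^sub>F i in U. Q K w i"
    unfolding eventually_sequentially by blast
  then have K1: "\<forall>\<^sub>F i in U. \<forall>w\<in>I3. Q K w i" if "K \<ge> K1" for K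
    using that by (intro eventually_ball_finite) auto
  obtain K2 K3 where gen: "\<forall>\<^sub>F i in U. B.generic i K2 (pt y i)" "\<forall>\<^sub>F i in U. B.generic i K3 (pt y' i)"
    using y(2) y'(2) by (auto simp: ultra_generic_def)
  define K where "K = max K1 (max K2 K3)"
  have le: "K1 \<le> K" "K2 \<le> K" "K3 \<le> K" by (auto simp: K_def)
  from K1[OF le(1)] gen E have "\<forall>\<^sub>F i in U. False"
  proof eventually_elim
    case (elim i)
    have "B.generic i K (pt y i)" and "B.generic i K (pt y' i)"
      using elim B.generic_mono le by blast+
    from B.codes_determine_edge[OF pt_in[OF y(1)] this(1) pt_in[OF y'(1)] this(2)] elim show ?case
      by (auto simp: Q_def)
  qed
  then show False using U_nontrivial by (simp add: eventually_False)
qed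

text \<open>Eventuality in \<open>K\<close> is written as a countable union of countable
  intersections of internal sets, which keeps the piece measurable. The choice recovers the
  coordinate missing from \<open>e\<close>.\<close>

definition piece :: "nat set \<Rightarrow> nat \<Rightarrow> (nat \<Rightarrow> (nat \<Rightarrow> 'a) set) set" where
  "piece e s = (let w = SOME w. w \<in> I3 - e in
    \<Union>K0. \<Inter>K\<in>{K0..}. internal_set U X e
      (\<lambda>i. {p \<in> PiE e (\<lambda>u. X u i). to_nat (B.code i K w p) = s}))"

text \<open>Class 0 collects the pairs without a type. Membership in it is informative as well, by
  \<open>no_type_imp_pos_neq_base\<close>.\<close>

definition partition :: "nat set \<Rightarrow> nat \<Rightarrow> (nat \<Rightarrow> (nat \<Rightarrow> 'a) set) set" where
  "partition e t = (case t of 0 \<Rightarrow> ultra_space U X e - (\<Union>s. piece e s) | Suc s \<Rightarrow> piece e s)"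

section \<open>Measurability, covering and disjointness of the type classes\<close>

lemma piece_sets: "piece e s \<in> sets (loeb_measure U X M e)"
proof -
  have "internal_set U X e (\<lambda>i. {p \<in> PiE e (\<lambda>u. X u i). P i p}) \<in> sets (loeb_measure U X M e)" for P
    by (rule internal_set_in_loeb) (rule Collect_restrict)
  then show ?thesis
    unfolding piece_def Let_def
    by (intro sets.countable_UN' sets.countable_INT' image_subsetI) simp_all
qed

lemma partition_sets: "partition e t \<in> sets (loeb_measure U X M e)"
proof (cases t)
  case 0
  have "ultra_space U X e \<in> sets (loeb_measure U X M e)"
    using sets.top[of "loeb_measure U X M e"] by simp
  then show ?thesis
    unfolding partition_def 0 by (auto intro!: sets.Diff sets.countable_UN'' piece_sets)
qed (simp add: partition_def piece_sets)

lemma piece_subset: "piece e s \<subseteq> ultra_space U X e"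
  unfolding piece_def Let_def
proof (rule UN_least)
  fix K0 :: nat
  show "(\<Inter>K\<in>{K0..}. internal_set U X e (Y K)) \<subseteq> ultra_space U X e" for Y
    by (rule INF_lower2[of K0]) (simp_all add: internal_set_subset)
qed

lemma partition_Union: "(\<Union>t. partition e t) = ultra_space U X e"
proof
  show "(\<Union>t. partition e t) \<subseteq> ultra_space U X e"
  proof (rule UN_least)
    show "partition e t \<subseteq> ultra_space U X e" for t
      using piece_subset by (cases t) (simp_all add: partition_def Diff_subset)
  qed
  show "ultra_space U X e \<subseteq> (\<Union>t. partition e t)"
  proof
    fix x assume x: "x \<in> ultra_space U X e"
    show "x \<in> (\<Union>t. partition e t)"
    proof (cases "\<exists>s. x \<in> piece e s")
      case True
      then obtain s where "x \<in> partition e (Suc s)" by (auto simp: partition_def)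
      then show ?thesis by blast
    next
      case False
      with x have "x \<in> partition e 0" by (auto simp: partition_def)
      then show ?thesis by blast
    qed
  qed
qed

text \<open>Codes read only the pair, so \<open>y\<close> may be arbitrary at \<open>w\<close>; this
  allows representatives of a full triple to be used for each of its pairs.\<close>

lemma mem_piece_iff:
  assumes x: "x \<in> ultra_space U X e" and y: "\<And>u. u \<in> e \<Longrightarrow> y u \<in> x u" and e: "e = I3 - {w}" "w \<in> I3"
  shows "x \<in> piece e s \<longleftrightarrow> has_type w s y"
proof -
  have "I3 - e = {w}" using e by auto
  then have w: "(SOME w. w \<in> I3 - e) = w" by auto
  have "finite e" using e by auto
  have *: "x \<in> internal_set U X e (\<lambda>i. {p \<in> PiE e (\<lambda>u. X u i). to_nat (B.code i K w p) = s}) \<longleftrightarrow>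
      (\<forall>\<^sub>F i in U. to_nat (B.code i K w (pt y i)) = s)" for K
  proof -
    have "y u i \<in> X u i" if "u \<in> e" for u i
    proof (rule ultraproduct_memberD[of "x u" U])
      show "x u \<in> ultraproduct U (X u)" using x that by (rule PiE_mem)
      show "y u \<in> x u" using that by (rule y)
    qed
    then have "(\<lambda>u\<in>e. y u i) \<in> PiE e (\<lambda>u. X u i)" for i by auto
    moreover have "B.code i K w (\<lambda>u\<in>e. y u i) = B.code i K w (pt y i)" for i
      using E_cong by (rule B.code_cong) (simp_all add: e pt_def)
    moreover have "x \<in> internal_set U X e Y \<longleftrightarrow> (\<forall>\<^sub>F i in U. (\<lambda>u\<in>e. y u i) \<in> Y i)" for Y
      using \<open>finite e\<close> x y by (rule internal_set_iff)
    ultimately show ?thesis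
      by (simp only: mem_Collect_eq simp_thms)
  qed
  show ?thesis
    unfolding piece_def w Let_def has_type_def eventually_sequentially
    by (simp add: *) (simp add: Ball_def)
qed

lemma has_type_unique: "has_type w s y \<Longrightarrow> has_type w s' y \<Longrightarrow> s = s'"
proof -
  assume "has_type w s y" "has_type w s' y"
  then have "\<forall>\<^sub>F K in sequentially. \<forall>\<^sub>F i in U. s = s'"
    unfolding has_type_def
  proof eventually_elim
    case (elim K)
    then show ?case by eventually_elim simp
  qed
  then show "s = s'" using U_nontrivial by (auto simp: eventually_const_iff)
qed

lemma partition_disjoint:
  assumes "e = I3 - {w}" "w \<in> I3"
  shows "disjoint_family (partition e)"
proof -
  have piece: "s = s'" if "x \<in> piece e s" "x \<in> piece e s'" for x s s'
  proof -
    have x: "x \<in> ultra_space U X e" using that piece_subset by blast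
    then have "\<forall>u\<in>e. \<exists>a. a \<in> x u" by (auto elim: ultraproduct_nonempty)
    then obtain y where "\<And>u. u \<in> e \<Longrightarrow> y u \<in> x u" by metis
    from mem_piece_iff[OF x this assms] that show ?thesis by (auto intro: has_type_unique)
  qed
  show ?thesis
    unfolding disjoint_family_on_def partition_def
    using piece by (auto split: nat.splits)
qed

lemma mem_partition_imp_same_type:
  assumes x: "x \<in> ultra_space U X I3" "\<And>u. u \<in> I3 \<Longrightarrow> y u \<in> x u"
    and x': "x' \<in> ultra_space U X I3" "\<And>u. u \<in> I3 \<Longrightarrow> y' u \<in> x' u"
    and w: "w \<in> I3" and mem: "restrict x (I3 - {w}) \<in> partition (I3 - {w}) t"
      "restrict x' (I3 - {w}) \<in> partition (I3 - {w}) t"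
  shows "has_type w s y \<longleftrightarrow> has_type w s y'"
proof -
  have "restrict x (I3 - {w}) \<in> piece (I3 - {w}) s \<longleftrightarrow> has_type w s y"
      "restrict x' (I3 - {w}) \<in> piece (I3 - {w}) s \<longleftrightarrow> has_type w s y'" for s
    using x x' w by (intro mem_piece_iff[OF _ _ refl w]; auto simp: PiE_iff)+
  then have "(t = Suc s) = has_type w s y" "(t = Suc s) = has_type w s y'"
    using mem has_type_unique by (auto simp: partition_def split: nat.splits)
  then show ?thesis by simp
qed

end

section \<open>Regularity of the ultraproduct function\<close>

lemma I3_eq: "I3 = {1..3}"
  by (auto simp: I3_def)

lemma pair_of_I3:
  assumes "e \<subseteq> I3" "card e = 2"
  obtains w where "w \<in> I3" "e = I3 - {w}"
proof -
  have "card I3 = 3" by (simp add: I3_def)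
  then have "card (I3 - e) = 1"
    using assms by (simp add: card_Diff_subset finite_subset[OF _ finite_I3])
  then obtain w where "I3 - e = {w}" by (rule card_1_singletonE)
  then show thesis using assms(1) by (intro that[of w]) auto
qed

text \<open>Off the null set of triples that are bad at every threshold,
  \<open>types_determine_edge\<close> applies. On each cylinder set the function is then almost
  everywhere a single value, 0 or 1, so one partition serves every error bound.\<close>

lemma (in ultra_branching) perfect_regularity:
  assumes M: "\<And>u i. u \<in> I3 \<Longrightarrow> prob_space (M u i) \<and> finite (X u i) \<and> sets (M u i) = Pow (X u i)"
    and net: "\<And>u i k h n. u \<in> I3 \<Longrightarrow> (\<And>j. j < net_size k \<Longrightarrow> \<not> agree n (g i u (c i u j)) h) \<Longrightarrow>
      measure (M u i) {z \<in> X u i. agree n (g i u z) h} \<le> 1 / real (Suc k)"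
  shows "perfect_stable_regularity_ultra 3 2 U X M (\<lambda>i p. of_bool (E i p))"
proof -
  define Bad where "Bad k i = {p \<in> PiE I3 (\<lambda>u. X u i). \<exists>u\<in>I3. B.bad i (net_size k) u p}" for k i
  define N where "N = (\<Inter>k. internal_set U X I3 (Bad k))"
  have Bad_sub: "Bad k i \<subseteq> PiE I3 (\<lambda>u. X u i)" for k i
    unfolding Bad_def by (rule Collect_restrict)
  \<comment> \<open>One summand \<open>1 / (k + 1)\<close> for each coordinate along which the set
    is sliced.\<close>
  have Bad_le: "measure (PiM I3 (\<lambda>u. M u i)) (Bad k i) \<le> 3 / real (Suc k)" for k i
  proof -
    define Q where "Q u = {p \<in> PiE I3 (\<lambda>u. X u i). B.bad i (net_size k) u p}" for u
    have le: "measure (PiM I3 (\<lambda>u. M u i)) (Q u) \<le> 1 / real (Suc k)" if u: "u \<in> I3" for u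
    proof (rule measure_PiM_le[where X = "\<lambda>u. X u i", OF finite_I3 u])
      show "Q u \<subseteq> PiE I3 (\<lambda>u. X u i)" unfolding Q_def by (rule Collect_restrict)
      fix y
      interpret Mu: prob_space "M u i" using M[OF u] by blast
      have "measure (M u i) {z \<in> X u i. y(u := z) \<in> Q u}
          \<le> measure (M u i) {z \<in> X u i. B.bad i (net_size k) u (y(u := z))}"
        using M[OF u] by (intro Mu.finite_measure_mono) (auto simp: Q_def)
      also have "\<dots> \<le> 1 / real (Suc k)"
        using M[OF u] net[OF u] u by (intro B.measure_bad_le) (auto intro: Mu.finite_measure)
      finally show "measure (M u i) {z \<in> X u i. y(u := z) \<in> Q u} \<le> 1 / real (Suc k)" .
    qed (use M in auto)
    have "Bad k i = (\<Union>u\<in>I3. Q u)" by (auto simp: Bad_def Q_def)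
    also have "measure (PiM I3 (\<lambda>u. M u i)) \<dots> \<le> (\<Sum>u\<in>I3. measure (PiM I3 (\<lambda>u. M u i)) (Q u))"
    proof (rule measure_UNION_le)
      show "Q u \<in> sets (PiM I3 (\<lambda>u. M u i))" for u
        using PiM_finite_discrete[of I3 "\<lambda>u. X u i" "\<lambda>u. M u i"] M by (auto simp: Q_def)
    qed simp
    also have "\<dots> \<le> (\<Sum>u\<in>I3. 1 / real (Suc k))"
      using le by (rule sum_mono)
    also have "\<dots> = 3 / real (Suc k)" by (simp add: I3_def)
    finally show ?thesis .
  qed
  have null: "N \<in> null_sets (loeb_measure U X M I3)"
    unfolding N_def using Bad_sub Bad_le by (rule null_Inter_internal)
  \<comment> \<open>Avoiding \<open>Bad k\<close> for one \<open>k\<close> makes the representatives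
    generic with cutoff \<open>net_size k\<close> along \<open>U\<close>.\<close>
  have rep: "\<exists>y. (\<forall>u\<in>I3. y u \<in> x u) \<and> y \<in> points \<and> ultra_generic y"
    if x: "x \<in> ultra_space U X I3" "x \<notin> N" for x
  proof -
    have "\<forall>u\<in>I3. \<exists>a. a \<in> x u"
      using x(1) by (auto elim: ultraproduct_nonempty)
    then obtain y where y: "\<And>u. u \<in> I3 \<Longrightarrow> y u \<in> x u" by metis
    have "y u i \<in> X u i" if u: "u \<in> I3" for u i
    proof (rule ultraproduct_memberD[of "x u" U])
      show "x u \<in> ultraproduct U (X u)" using x(1) u by (rule PiE_mem)
    qed (rule y[OF u])
    then have pts: "y \<in> points" by (simp add: points_def)
    obtain k where "x \<notin> internal_set U X I3 (Bad k)"
      using x(2) by (auto simp: N_def)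
    moreover have "x \<in> internal_set U X I3 (Bad k) \<longleftrightarrow> (\<forall>\<^sub>F i in U. (\<lambda>u\<in>I3. y u i) \<in> Bad k i)"
      using finite_I3 x(1) y by (rule internal_set_iff)
    ultimately have "\<forall>\<^sub>F i in U. (\<lambda>u\<in>I3. y u i) \<notin> Bad k i"
      by (simp add: not_eventually_iff)
    then have "\<forall>\<^sub>F i in U. B.generic i (net_size k) (pt y i)"
    proof eventually_elim
      case (elim i)
      show ?case
      proof (rule ccontr)
        assume "\<not> B.generic i (net_size k) (pt y i)"
        then obtain u where u: "u \<in> I3" "B.bad i (net_size k) u (pt y i)"
          using B.not_generic_imp_bad[OF pt_in[OF pts]] by blast
        have "B.bad i (net_size k) u (pt y i) = B.bad i (net_size k) u (\<lambda>u\<in>I3. y u i)"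
          by (rule B.bad_cong) (simp_all add: pt_def)
        moreover have "(\<lambda>u\<in>I3. y u i) \<in> PiE I3 (\<lambda>u. X u i)"
          using pts by (simp add: points_def)
        ultimately show False using elim u by (auto simp: Bad_def)
      qed
    qed
    then show ?thesis using y pts by (auto simp: ultra_generic_def)
  qed
  have fn: "ultra_fun 3 U (\<lambda>i p. of_bool (E i p)) x = of_bool (\<forall>\<^sub>F i in U. E i (pt y i))"
    if "x \<in> ultra_space U X I3" "\<forall>u\<in>I3. y u \<in> x u" for x y
  proof -
    have "E i (\<lambda>u\<in>{1..3}. y u i) = E i (pt y i)" for i
      by (rule E_cong) (simp add: pt_def I3_eq)
    moreover have "ultra_fun 3 U (\<lambda>i p. of_bool (E i p)) x = of_bool (\<forall>\<^sub>F i in U. E i (\<lambda>u\<in>{1..3}. y u i))"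
      using that by (intro ultra_fun_of_bool) (simp_all add: I3_eq)
    ultimately show ?thesis by simp
  qed
  define good where "good t x \<longleftrightarrow> x \<in> ultra_space U X I3 \<and> x \<notin> N \<and>
      (\<forall>w\<in>I3. restrict x (I3 - {w}) \<in> partition (I3 - {w}) (t (I3 - {w})))" for t x
  \<comment> \<open>Carrying over the value 1 suffices: only 0 and 1 occur, so good points with the
    same classes share their value.\<close>
  have same: "ultra_fun 3 U (\<lambda>i p. of_bool (E i p)) x' = 1"
    if x: "good t x" and x': "good t x'" and one: "ultra_fun 3 U (\<lambda>i p. of_bool (E i p)) x = 1" for t x x'
  proof -
    obtain y where y: "\<forall>u\<in>I3. y u \<in> x u" "y \<in> points" "ultra_generic y"
      using rep[of x] x by (auto simp: good_def)
    obtain y' where y': "\<forall>u\<in>I3. y' u \<in> x' u" "y' \<in> points" "ultra_generic y'"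
      using rep[of x'] x' by (auto simp: good_def)
    have types: "has_type w s y \<longleftrightarrow> has_type w s y'" if "w \<in> I3" for w s
      using x x' y(1) y'(1) that
        mem_partition_imp_same_type[of x y x' y' w "t (I3 - {w})"] by (auto simp: good_def)
    have "\<forall>\<^sub>F i in U. E i (pt y i)"
      using fn[of x y] x y(1) one by (auto simp: good_def split: if_splits)
    then have "\<not> (\<forall>\<^sub>F i in U. \<not> E i (pt y' i))"
      using types_determine_edge[OF y(2,3) y'(2,3) types] by blast
    then have "\<forall>\<^sub>F i in U. E i (pt y' i)"
      by (simp add: not_eventually_iff)
    then show ?thesis
      using fn[of x' y'] x' y'(1) by (auto simp: good_def)
  qed
  show ?thesis
    unfolding perfect_stable_regularity_ultra_def I3_eq[symmetric]
  proof (intro allI impI exI[of _ partition] conjI)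
    fix e :: "nat set" assume "e \<subseteq> I3 \<and> card e = 2"
    then obtain w where w: "w \<in> I3" "e = I3 - {w}" using pair_of_I3 by blast
    show "range (partition e) \<subseteq> sets (loeb_measure U X M e)"
      using partition_sets by blast
    show "disjoint_family (partition e)"
      using w(2,1) by (rule partition_disjoint)
    show "(\<Union>t. partition e t) = ultra_space U X e"
      by (rule partition_Union)
  next
    fix \<epsilon> :: real and t :: "nat set \<Rightarrow> nat" assume "0 < \<epsilon>"
    \<comment> \<open>The common value on the good points, used as a degenerate interval. Without
      good points \<open>b\<close> is 0 and the claim about them is vacuous.\<close>
    define b where "b = (of_bool (\<exists>x. good t x \<and> ultra_fun 3 U (\<lambda>i p. of_bool (E i p)) x = 1) :: real)"
    have val: "ultra_fun 3 U (\<lambda>i p. of_bool (E i p)) x = b" if x: "good t x" for x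
    proof -
      obtain y where "\<forall>u\<in>I3. y u \<in> x u" using rep[of x] x by (auto simp: good_def)
      then have "ultra_fun 3 U (\<lambda>i p. of_bool (E i p)) x \<in> {0, 1}"
        using fn[of x y] x by (auto simp: good_def)
      then show ?thesis
        using same[OF _ x] x by (auto simp: b_def)
    qed
    have "AE x in loeb_measure U X M I3. (\<forall>e. e \<subseteq> I3 \<and> card e = 2 \<longrightarrow> restrict x e \<in> partition e (t e))
        \<longrightarrow> ultra_fun 3 U (\<lambda>i p. of_bool (E i p)) x \<in> {b..b}"
    proof (rule AE_I'[OF null], rule subsetI, rule ccontr)
      fix x
      assume x: "x \<in> {x \<in> space (loeb_measure U X M I3). \<not> ((\<forall>e. e \<subseteq> I3 \<and> card e = 2 \<longrightarrow>
          restrict x e \<in> partition e (t e)) \<longrightarrow> ultra_fun 3 U (\<lambda>i p. of_bool (E i p)) x \<in> {b..b})}"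
        and "x \<notin> N"
      have "card (I3 - {w}) = 2" if "w \<in> I3" for w
        using that by (simp add: I3_def card_Diff_singleton)
      then have "good t x"
        using x \<open>x \<notin> N\<close> by (auto simp: good_def)
      from val[OF this] show False using x by simp
    qed
    then show "\<exists>a b. 0 \<le> a \<and> a \<le> b \<and> b \<le> 1 \<and> b - a \<le> \<epsilon> \<and>
        (AE x in loeb_measure U X M I3. (\<forall>e. e \<subseteq> I3 \<and> card e = 2 \<longrightarrow> restrict x e \<in> partition e (t e))
        \<longrightarrow> ultra_fun 3 U (\<lambda>i p. of_bool (E i p)) x \<in> {a..b})"
      using \<open>0 < \<epsilon>\<close> by (intro exI[of _ b] conjI) (simp_all add: b_def)
  qed
qed

section \<open>Perfect stable regularity\<close>

theorem theorem3p9: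
  fixes H :: "nat \<Rightarrow> 'a hypergraph3"
  assumes "\<And>i. tripartite3 (H i)"
    and "\<And>i. finite_hypergraph3 (H i)"
    and "\<And>i. embeds_induced (H i) GS3"
    and "\<And>i. embeds_induced (H i) half_simplex"
  shows "perfect_stable_regularity 3 2 (range (\<lambda>i. (hypergraph_fun (H i), part (H i))))"
  unfolding perfect_stable_regularity_def
proof (intro allI impI, elim conjE)
  fix f :: "nat \<Rightarrow> (nat \<Rightarrow> 'a) \<Rightarrow> real" and X :: "nat \<Rightarrow> nat \<Rightarrow> 'a set"
    and M :: "nat \<Rightarrow> nat \<Rightarrow> 'a measure" and U :: "nat filter"
  assume mem: "\<forall>i. (f i, \<lambda>u. X u i) \<in> range (\<lambda>i. (hypergraph_fun (H i), part (H i)))"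
    and M: "\<forall>u\<in>{1..3}. \<forall>i. prob_space (M u i) \<and> sets (M u i) = Pow (X u i)"
    and U: "nonprincipal_ultrafilter U"
  \<comment> \<open>A sequence of members may repeat or reorder the hypergraphs; \<open>j i\<close>
    is the index of the one at stage \<open>i\<close>.\<close>
  from mem have "\<forall>i. \<exists>j. f i = hypergraph_fun (H j) \<and> (\<lambda>u. X u i) = part (H j)" by auto
  then obtain j where j: "\<And>i. f i = hypergraph_fun (H (j i))" "\<And>i. (\<lambda>u. X u i) = part (H (j i))"
    by metis
  define E where "E i x \<longleftrightarrow> (x 1, x 2, x 3) \<in> edges (H (j i))" for i and x :: "nat \<Rightarrow> 'a"
  have X: "X u i = part (H (j i)) u" for u i
    using j(2) by (metis (mono_tags))
  have "\<exists>g. \<forall>u\<in>{1, 2, 3}. inj_on (g u) (part (H i) u) \<and>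
      (\<forall>x\<in>part (H i) 1. \<forall>y\<in>part (H i) 2. \<forall>z\<in>part (H i) 3.
        (x, y, z) \<in> edges (H i) \<longleftrightarrow> (g 1 x, g 2 y, g 3 z) \<in> edges GS3)" for i
    using assms(3)[of i] unfolding embeds_induced_def by blast
  then obtain G where G: "\<And>i u. u \<in> I3 \<Longrightarrow> inj_on (G i u) (part (H i) u)"
    "\<And>i x y z. x \<in> part (H i) 1 \<Longrightarrow> y \<in> part (H i) 2 \<Longrightarrow> z \<in> part (H i) 3 \<Longrightarrow>
        (x, y, z) \<in> edges (H i) \<longleftrightarrow> (G i 1 x, G i 2 y, G i 3 z) \<in> edges GS3"
    unfolding I3_def by (metis insertI1)
  have dec: "decided_branching (part (H i)) (G i) (\<lambda>x. (x 1, x 2, x 3) \<in> edges (H i))" for i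
  proof -
    obtain a where a: "\<forall>u\<in>{1, 2, 3}. a u \<in> part (H i) u \<rightarrow> part half_simplex u"
      "\<forall>x\<in>part (H i) 1. \<forall>y\<in>part (H i) 2. \<forall>z\<in>part (H i) 3.
        (x, y, z) \<in> edges (H i) \<longleftrightarrow> (a 1 x, a 2 y, a 3 z) \<in> edges half_simplex"
      using assms(4)[of i] unfolding embeds_induced_def by blast
    show ?thesis
    proof (rule decided_branching_hypergraph[where a = a])
      fix x y z assume xyz: "x \<in> part (H i) 1" "y \<in> part (H i) 2" "z \<in> part (H i) 3"
      then have "a 1 x \<in> {0..1}" "a 2 y \<in> {0..1}" "a 3 z \<in> {0..1}"
        using a(1) by (auto simp: half_simplex_def Pi_iff)
      then show "(x, y, z) \<in> edges (H i) \<longleftrightarrow> 1 \<le> a 1 x + a 2 y + a 3 z"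
        using a(2) xyz by (auto simp: half_simplex_def)
    qed (use assms(2) G in auto)
  qed
  have fin: "finite (X u i)" if "u \<in> I3" for u i
    using assms(2)[of "j i"] that by (auto simp: finite_hypergraph3_def I3_def X)
  have pr: "prob_space (M u i) \<and> finite (X u i) \<and> sets (M u i) = Pow (X u i)" if "u \<in> I3" for u i
    using M fin that by (simp add: I3_eq)
  define net where "net i u c \<longleftrightarrow> (\<forall>k h n. (\<forall>l<net_size k. \<not> agree n (G (j i) u (c l)) h) \<longrightarrow>
      measure (M u i) {z \<in> X u i. agree n (G (j i) u z) h} \<le> 1 / real (Suc k))" for i u c
  have ex: "\<exists>c. net i u c" if u: "u \<in> I3" for u i
  proof -
    have fps: "finite (X u i)" "prob_space (M u i)" "sets (M u i) = Pow (X u i)"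
      using pr[OF u] by auto
    show ?thesis
    proof (rule exists_landmarks[OF fps, where f = "G (j i) u"])
      fix c assume c: "\<And>k h n. (\<And>l. l < net_size k \<Longrightarrow> \<not> agree n (G (j i) u (c l)) h) \<Longrightarrow>
        measure (M u i) {z \<in> X u i. agree n (G (j i) u z) h} \<le> 1 / real (Suc k)"
      show ?thesis
        unfolding net_def by (intro exI[of _ c] allI impI c) blast
    qed
  qed
  \<comment> \<open>Landmarks depend on the measures \<open>M u i\<close> and are therefore chosen
    separately for every stage and part.\<close>
  define c where "c i u = (SOME c. net i u c)" for i u
  have c: "net i u (c i u)" if "u \<in> I3" for i u
    unfolding c_def using ex[OF that] by (rule someI_ex[of "net i u"])
  interpret ultra_branching U X "\<lambda>i. G (j i)" E c
  proof (intro ultra_branching.intro ultra.intro ultra_branching_axioms.intro)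
    show "nonprincipal_ultrafilter U" by (rule U)
    show "decided_branching (\<lambda>u. X u i) (G (j i)) (E i)" for i
    proof -
      have "E i = (\<lambda>x. (x 1, x 2, x 3) \<in> edges (H (j i)))" by (simp add: fun_eq_iff E_def)
      with dec[of "j i"] show ?thesis by (simp only: j(2))
    qed
    show "E i x = E i x'" if "\<And>u. u \<in> I3 \<Longrightarrow> x u = x' u" for i x x'
      using that by (simp add: E_def I3_def)
  qed
  have "f = (\<lambda>i p. of_bool (E i p))"
    using j(1) by (simp add: fun_eq_iff hypergraph_fun_def E_def)
  then show "perfect_stable_regularity_ultra 3 2 U X M f"
    using perfect_regularity[of M] pr c unfolding net_def by simp
qed

end
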